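(* Let $W^{(1)}$ be a pro-$p$ Coxeter group (notation as in the context), $R$ a commutative ring, and let $(a_s)_{s\in S}$, $(b_s)_{s\in S}$ be families with $a_s\in R$ and $b_s\in R[T]$ such that for all $s,t\in S$ and $w\in W^{(1)}$ with $s\pi(w)=\pi(w)t$ the following hold (note $n_swn_t^{-1}w^{-1}\in T$): \[ a_s=a_t,\qquad (n_swn_t^{-1}w^{-1})\cdot w(b_t)=b_s \ \text{ in } R[T]. \] Then there exists a unique structure of an $R$-algebra on the free $R$-module $M$ with basis $\{T_w\}_{w\in W^{(1)}}$, compatible with its $R$-module structure, such that (1) $T_{ww'}=T_wT_{w'}$ for all $w,w'\in W^{(1)}$ with $\ell(ww')=\ell(w)+\ell(w')$, and (2) $T_{n_s}^2=a_sT_{n_s^2}+T_{n_s}b_s$ for all $s\in S$, where in (2) $R[T]$ is regarded as a subalgebra of $M$ via $t\mapsto T_t$ (which by (1) is an algebra embedding since $\ell$ vanishes on $T$).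
   Context: A Coxeter group $(W_{\mathrm{aff}},S)$ has length function $\ell$ and $m(s,t)$ denotes the order of $st$. An extended Coxeter group is a group $W=W_{\mathrm{aff}}\rtimes\Omega$ with $W_{\mathrm{aff}}$ normal, $(W_{\mathrm{aff}},S)$ a Coxeter group and $\Omega$ a subgroup whose conjugation action preserves $S$; the length extends by $\ell(wu)=\ell(w)$ ($w\in W_{\mathrm{aff}},u\in\Omega$). A pro-$p$ Coxeter group $W^{(1)}$ consists of an extended Coxeter group $W$, an abelian group $T$, an extension $1\to T\to W^{(1)}\xrightarrow{\pi}W\to1$ with $T\subseteq W^{(1)}$, and lifts $n_s\in\pi^{-1}(s)$ ($s\in S$) satisfying the braid relations $n_sn_tn_s\cdots=n_tn_sn_t\cdots$ ($m(s,t)$ factors each side) whenever $m(s,t)<\infty$. The length on $W^{(1)}$ is $\ell\circ\pi$. $W^{(1)}$ acts on $T$ by conjugation, $w(t)=wtw^{-1}$, and this extends to an action on the group algebra $R[T]$ by $R$-algebra automorphisms. *)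

theory Defs
  imports "HOL-Algebra.Algebra" "HOL-Library.Function_Algebras"
begin

definition word_eval :: "('a, 'b) monoid_scheme \<Rightarrow> 'a list \<Rightarrow> 'a" where
  "word_eval G xs = foldr (\<lambda>x acc. x \<otimes>\<^bsub>G\<^esub> acc) xs \<one>\<^bsub>G\<^esub>"

definition alt_prod :: "('a, 'b) monoid_scheme \<Rightarrow> 'a \<Rightarrow> 'a \<Rightarrow> nat \<Rightarrow> 'a" where
  "alt_prod G x y k = word_eval G (map (\<lambda>i. if even i then x else y) [0..<k])"

text \<open>m(s,t): the order of st (0 encodes infinite order).\<close>
definition cox_m :: "('a, 'b) monoid_scheme \<Rightarrow> 'a \<Rightarrow> 'a \<Rightarrow> nat" where
  "cox_m G s t = group.ord G (s \<otimes>\<^bsub>G\<^esub> t)"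

text \<open>Coxeter relators (st)^{m(s,t)} for m(s,t) finite (including s = t, giving s^2).\<close>
definition cox_relators :: "('a, 'b) monoid_scheme \<Rightarrow> 'a set \<Rightarrow> 'a list set" where
  "cox_relators G S = {concat (replicate (cox_m G s t) [s, t]) | s t.
      s \<in> S \<and> t \<in> S \<and> cox_m G s t \<noteq> 0}"

definition cox_step :: "('a, 'b) monoid_scheme \<Rightarrow> 'a set \<Rightarrow> ('a list \<times> 'a list) set" where
  "cox_step G S = {(u @ r @ v, u @ v) | u r v. r \<in> cox_relators G S}"

definition cox_equiv :: "('a, 'b) monoid_scheme \<Rightarrow> 'a set \<Rightarrow> ('a list \<times> 'a list) set" where
  "cox_equiv G S = (cox_step G S \<union> (cox_step G S)\<inverse>)\<^sup>*"

text \<open>(G,S) is a Coxeter system: S is a generating set of involutions and G is presented by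
  the generators S and the relations (st)^{m(s,t)} = 1 (m(s,t) finite), i.e. every word in S
  evaluating to 1 is a consequence of the relators.\<close>
definition coxeter_system :: "('a, 'b) monoid_scheme \<Rightarrow> 'a set \<Rightarrow> bool" where
  "coxeter_system G S \<longleftrightarrow>
     group G \<and> S \<subseteq> carrier G \<and>
     (\<forall>s\<in>S. s \<noteq> \<one>\<^bsub>G\<^esub> \<and> s \<otimes>\<^bsub>G\<^esub> s = \<one>\<^bsub>G\<^esub>) \<and>
     generate G S = carrier G \<and>
     (\<forall>w \<in> lists S. word_eval G w = \<one>\<^bsub>G\<^esub> \<longrightarrow> (w, []) \<in> cox_equiv G S)"

definition cox_length :: "('a, 'b) monoid_scheme \<Rightarrow> 'a set \<Rightarrow> 'a \<Rightarrow> nat" where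
  "cox_length G S w = (LEAST n. \<exists>xs \<in> lists S. length xs = n \<and> word_eval G xs = w)"

definition extended_coxeter :: "'a monoid \<Rightarrow> 'a set \<Rightarrow> 'a set \<Rightarrow> 'a set \<Rightarrow> bool" where
  "extended_coxeter W Waff Omega S \<longleftrightarrow>
     group W \<and> Waff \<lhd> W \<and> coxeter_system (W\<lparr>carrier := Waff\<rparr>) S \<and>
     subgroup Omega W \<and> Waff \<inter> Omega = {\<one>\<^bsub>W\<^esub>} \<and> Waff <#>\<^bsub>W\<^esub> Omega = carrier W \<and>
     (\<forall>u\<in>Omega. \<forall>s\<in>S. u \<otimes>\<^bsub>W\<^esub> s \<otimes>\<^bsub>W\<^esub> inv\<^bsub>W\<^esub> u \<in> S)"

definition ext_length :: "'a monoid \<Rightarrow> 'a set \<Rightarrow> 'a set \<Rightarrow> 'a set \<Rightarrow> 'a \<Rightarrow> nat" where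
  "ext_length W Waff Omega S x =
     (THE n. \<exists>w\<in>Waff. \<exists>u\<in>Omega. x = w \<otimes>\<^bsub>W\<^esub> u \<and> n = cox_length (W\<lparr>carrier := Waff\<rparr>) S w)"

definition pro_p_coxeter ::
  "'g monoid \<Rightarrow> 'g set \<Rightarrow> 'w monoid \<Rightarrow> 'w set \<Rightarrow> 'w set \<Rightarrow> 'w set \<Rightarrow> ('g \<Rightarrow> 'w) \<Rightarrow> ('w \<Rightarrow> 'g) \<Rightarrow> bool"
  where
  "pro_p_coxeter W1 T W Waff Omega S proj n \<longleftrightarrow>
     group W1 \<and> extended_coxeter W Waff Omega S \<and>
     subgroup T W1 \<and> (\<forall>x\<in>T. \<forall>y\<in>T. x \<otimes>\<^bsub>W1\<^esub> y = y \<otimes>\<^bsub>W1\<^esub> x) \<and>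
     proj \<in> hom W1 W \<and> proj ` carrier W1 = carrier W \<and> kernel W1 W proj = T \<and>
     (\<forall>s\<in>S. n s \<in> carrier W1 \<and> proj (n s) = s) \<and>
     (\<forall>s\<in>S. \<forall>t\<in>S. cox_m W s t \<noteq> 0 \<longrightarrow>
        alt_prod W1 (n s) (n t) (cox_m W s t) = alt_prod W1 (n t) (n s) (cox_m W s t))"

definition fsupp :: "('g \<Rightarrow> 'r::zero) \<Rightarrow> 'g set" where
  "fsupp f = {x. f x \<noteq> 0}"

text \<open>Finitely supported functions A \<rightarrow> R: the free R-module with basis A
  (R[T] for A = T; the module M for A = carrier W1). R[T] sits inside M by inclusion,
  i.e. t \<mapsto> T_t.\<close>
definition free_mod :: "'g set \<Rightarrow> ('g \<Rightarrow> 'r::zero) set" where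
  "free_mod A = {f. finite (fsupp f) \<and> fsupp f \<subseteq> A}"

definition basis_el :: "'g \<Rightarrow> 'g \<Rightarrow> 'r::{zero,one}" where
  "basis_el w = (\<lambda>y. if y = w then 1 else 0)"

definition smult_fun :: "'r::times \<Rightarrow> ('g \<Rightarrow> 'r) \<Rightarrow> 'g \<Rightarrow> 'r" where
  "smult_fun c f = (\<lambda>x. c * f x)"

definition conv :: "('g, 'b) monoid_scheme \<Rightarrow> ('g \<Rightarrow> 'r::comm_ring_1) \<Rightarrow> ('g \<Rightarrow> 'r) \<Rightarrow> 'g \<Rightarrow> 'r" where
  "conv G f g = (\<lambda>x. if x \<in> carrier G then (\<Sum>y\<in>fsupp f. f y * g (inv\<^bsub>G\<^esub> y \<otimes>\<^bsub>G\<^esub> x)) else 0)"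

text \<open>Conjugation action w(f), induced by t \<mapsto> w t w^{-1}.\<close>
definition conj_act :: "('g, 'b) monoid_scheme \<Rightarrow> 'g \<Rightarrow> ('g \<Rightarrow> 'r::zero) \<Rightarrow> 'g \<Rightarrow> 'r" where
  "conj_act G w f = (\<lambda>x. if x \<in> carrier G then f (inv\<^bsub>G\<^esub> w \<otimes>\<^bsub>G\<^esub> x \<otimes>\<^bsub>G\<^esub> w) else 0)"

definition is_R_algebra_mult :: "('g \<Rightarrow> 'r::comm_ring_1) set \<Rightarrow>
    (('g \<Rightarrow> 'r) \<Rightarrow> ('g \<Rightarrow> 'r) \<Rightarrow> ('g \<Rightarrow> 'r)) \<Rightarrow> bool" where
  "is_R_algebra_mult M mul \<longleftrightarrow>
     (\<forall>x\<in>M. \<forall>y\<in>M. mul x y \<in> M) \<and>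
     (\<forall>x\<in>M. \<forall>y\<in>M. \<forall>z\<in>M. mul (x + y) z = mul x z + mul y z) \<and>
     (\<forall>x\<in>M. \<forall>y\<in>M. \<forall>z\<in>M. mul x (y + z) = mul x y + mul x z) \<and>
     (\<forall>c. \<forall>x\<in>M. \<forall>y\<in>M. mul (smult_fun c x) y = smult_fun c (mul x y)) \<and>
     (\<forall>c. \<forall>x\<in>M. \<forall>y\<in>M. mul x (smult_fun c y) = smult_fun c (mul x y)) \<and>
     (\<forall>x\<in>M. \<forall>y\<in>M. \<forall>z\<in>M. mul (mul x y) z = mul x (mul y z)) \<and>
     (\<exists>e\<in>M. \<forall>x\<in>M. mul e x = x \<and> mul x e = x)"

end

theory Submission
  imports Defs
begin

text \<open>
  For $s \in S$ the two conditions force the operators of left and right multiplication by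
  $T_{n_s}$ on the free module $M$. The forced left operators commute with the forced right
  operators: the only case that is not formal is $s w = w t$ in $W$ (which the exchange condition
  produces as soon as $\ell(s w) = \ell(w t)$ and $\ell(s w t) = \ell(w)$), and there it amounts to
  the compatibility of $(a_s)$ and $(b_s)$. An operator on $M$ that commutes with all right
  operators is determined by its value at $T_1$, and every element of $M$ is such a value; hence
  evaluation at $T_1$ identifies $M$ with an algebra of operators, which supplies the product.
\<close>

text \<open>Relation (2) has b_s to the right of T_{n_s}, while computing T_{n_s} T_w for w = n_s v
  with v shorter needs it on the left, where T_{n_s} T_v can be recombined to T_w. Compatibility at
  w = n_s closes this gap: it says that b_s is invariant under conjugation by n_s, so b_s commutes
  with T_{n_s}.

  The elements of length zero are all lifts of \<open>Omega\<close>, not only the identity or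
  \<open>T\<close>. Hence the operators for the n_s alone do not reach all of M from T_1: inductions
  on the length start at arbitrary length-zero elements, and the operators also have to commute with
  multiplication by these. The group \<open>W\<close> enters the algebraic part only through the
  length on \<open>W1\<close>, its behaviour under multiplication, descents, and folding.\<close>

subsection \<open>Coxeter groups: length and folding\<close>

text \<open>Whether the reflection $r$ occurs an odd number of times among the reflections
  $s_1 \cdots s_{i-1} s_i s_{i-1} \cdots s_1$ of the word. This depends only on the value of the word,
  which yields the exchange condition.\<close>

primrec crosses :: "('a, 'b) monoid_scheme \<Rightarrow> 'a list \<Rightarrow> 'a \<Rightarrow> bool" where
  "crosses G [] r \<longleftrightarrow> False"
| "crosses G (s # xs) r \<longleftrightarrow> (r = s) \<noteq> crosses G xs (s \<otimes>\<^bsub>G\<^esub> r \<otimes>\<^bsub>G\<^esub> s)"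

locale coxeter_group = group G for G (structure) +
  fixes S :: "'a set"
  assumes coxeter: "coxeter_system G S"
begin

section \<open>Generators, words and the Coxeter length\<close>

lemma gen_closed [simp]: "s \<in> S \<Longrightarrow> s \<in> carrier G"
  and gen_square [simp]: "s \<in> S \<Longrightarrow> s \<otimes> s = \<one>"
  using coxeter by (auto simp: coxeter_system_def)

lemma gen_inv [simp]: "s \<in> S \<Longrightarrow> inv s = s"
  by (rule inv_equality) auto

lemma gen_cancel [simp]: "s \<in> S \<Longrightarrow> x \<in> carrier G \<Longrightarrow> s \<otimes> (s \<otimes> x) = x"
  by (simp flip: m_assoc)

lemma gen_cancel_right [simp]: "s \<in> S \<Longrightarrow> x \<in> carrier G \<Longrightarrow> x \<otimes> s \<otimes> s = x"
  by (simp add: m_assoc)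

lemma eval_Nil [simp]: "word_eval G [] = \<one>"
  and eval_Cons [simp]: "word_eval G (x # xs) = x \<otimes> word_eval G xs"
  by (simp_all add: word_eval_def)

lemma eval_closed [simp]: "set xs \<subseteq> S \<Longrightarrow> word_eval G xs \<in> carrier G"
  by (induction xs) auto

lemma eval_append [simp]:
  "set xs \<subseteq> S \<Longrightarrow> set ys \<subseteq> S \<Longrightarrow> word_eval G (xs @ ys) = word_eval G xs \<otimes> word_eval G ys"
  by (induction xs) (auto simp: m_assoc)

lemma eval_rev [simp]: "set xs \<subseteq> S \<Longrightarrow> word_eval G (rev xs) = inv (word_eval G xs)"
  by (induction xs) (auto simp: inv_mult_group)

lemma ex_word:
  assumes "x \<in> carrier G"
  shows "\<exists>xs. set xs \<subseteq> S \<and> word_eval G xs = x"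
proof -
  have "x \<in> generate G S" using assms coxeter by (simp add: coxeter_system_def)
  then show ?thesis
  proof (induction x)
    case one
    show ?case by (rule exI[of _ "[]"]) auto
  next
    case (incl h)
    then show ?case by (intro exI[of _ "[h]"]) auto
  next
    case (inv h)
    then show ?case by (intro exI[of _ "[h]"]) auto
  next
    case (eng h1 h2)
    then obtain xs ys where "set xs \<subseteq> S" "word_eval G xs = h1" "set ys \<subseteq> S" "word_eval G ys = h2"
      by auto
    then show ?case by (intro exI[of _ "xs @ ys"]) auto
  qed
qed

lemma ex_reduced:
  assumes "x \<in> carrier G"
  obtains xs where "set xs \<subseteq> S" "word_eval G xs = x" "length xs = cox_length G S x"
proof -
  have "\<exists>n. \<exists>xs\<in>lists S. length xs = n \<and> word_eval G xs = x"
    using ex_word[OF assms] by (auto simp: lists_eq_set)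
  then have "\<exists>xs\<in>lists S. length xs = cox_length G S x \<and> word_eval G xs = x"
    unfolding cox_length_def by (rule LeastI_ex)
  then show ?thesis using that by (auto simp: lists_eq_set)
qed

lemma cox_length_le: "set xs \<subseteq> S \<Longrightarrow> cox_length G S (word_eval G xs) \<le> length xs"
  unfolding cox_length_def by (rule Least_le) (auto simp: lists_eq_set)

lemma cox_length_one [simp]: "cox_length G S \<one> = 0"
  using cox_length_le[of "[]"] by simp

lemma cox_length_eq_0: "x \<in> carrier G \<Longrightarrow> cox_length G S x = 0 \<Longrightarrow> x = \<one>"
  by (metis ex_reduced eval_Nil length_0_conv)

lemma cox_length_inv:
  assumes "x \<in> carrier G"
  shows "cox_length G S (inv x) = cox_length G S x"
proof -
  have *: "cox_length G S (inv y) \<le> cox_length G S y" if "y \<in> carrier G" for y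
    by (rule ex_reduced[OF that]) (metis cox_length_le eval_rev length_rev set_rev)
  show ?thesis using *[OF assms] *[of "inv x"] assms by auto
qed

lemma cox_length_gen_mult_le:
  assumes "s \<in> S" "x \<in> carrier G"
  shows "cox_length G S (s \<otimes> x) \<le> Suc (cox_length G S x)"
proof (rule ex_reduced[OF assms(2)])
  fix xs assume "set xs \<subseteq> S" "word_eval G xs = x" "length xs = cox_length G S x"
  then show ?thesis using cox_length_le[of "s # xs"] assms by auto
qed

section \<open>Parity of the occurrences of a reflection in a word\<close>

lemma crosses_append:
  assumes "set xs \<subseteq> S" "set ys \<subseteq> S" "r \<in> carrier G"
  shows "crosses G (xs @ ys) r \<longleftrightarrow>
    crosses G xs r \<noteq> crosses G ys (inv (word_eval G xs) \<otimes> r \<otimes> word_eval G xs)"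
  using assms
proof (induction xs arbitrary: r)
  case (Cons s xs)
  then have "inv (word_eval G xs) \<otimes> (s \<otimes> r \<otimes> s) \<otimes> word_eval G xs =
     inv (s \<otimes> word_eval G xs) \<otimes> r \<otimes> (s \<otimes> word_eval G xs)"
    by (simp add: inv_mult_group m_assoc)
  with Cons show ?case by auto
qed auto

text \<open>The word (st)^k has 2k letters, and its reflections are the (st)^i s for i < 2k.
  Dropping the first two letters conjugates \<open>r\<close> by ts, which shifts the index by
  two.\<close>

lemma crosses_dihedral:
  assumes "s \<in> S" "t \<in> S" "r \<in> carrier G"
  shows "crosses G (concat (replicate k [s, t])) r \<longleftrightarrow>
    odd (\<Sum>i<2*k. of_bool (r = (s \<otimes> t) [^] i \<otimes> s) :: nat)"
  using assms
proof (induction k arbitrary: r)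
  case (Suc k)
  define r' where "r' = t \<otimes> (s \<otimes> r \<otimes> s) \<otimes> t"
  have [simp]: "r' \<in> carrier G" using Suc.prems by (auto simp: r'_def)
  have r: "r = s \<otimes> (t \<otimes> (r' \<otimes> (t \<otimes> s)))"
    using Suc.prems by (simp add: r'_def m_assoc)
  have shift: "r = (s \<otimes> t) [^] (Suc (Suc i)) \<otimes> s \<longleftrightarrow> r' = (s \<otimes> t) [^] i \<otimes> s" for i :: nat
  proof -
    have "(s \<otimes> t) [^] (Suc (Suc i)) \<otimes> s = (s \<otimes> t) [^] (Suc i) \<otimes> (s \<otimes> t \<otimes> s)"
      using Suc.prems by (simp add: m_assoc)
    also have "\<dots> = s \<otimes> t \<otimes> ((s \<otimes> t) [^] i \<otimes> (s \<otimes> (t \<otimes> s)))"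
      using Suc.prems by (subst nat_pow_Suc2) (auto simp: m_assoc)
    also have "\<dots> = s \<otimes> (t \<otimes> (((s \<otimes> t) [^] i \<otimes> s) \<otimes> (t \<otimes> s)))"
      using Suc.prems by (simp add: m_assoc)
    finally show ?thesis using Suc.prems by (simp add: r)
  qed
  have one: "s \<otimes> r \<otimes> s = t \<longleftrightarrow> r = s \<otimes> t \<otimes> s"
  proof
    assume "s \<otimes> r \<otimes> s = t"
    then show "r = s \<otimes> t \<otimes> s" using Suc.prems by (auto simp: m_assoc)
  next
    assume "r = s \<otimes> t \<otimes> s"
    then show "s \<otimes> r \<otimes> s = t" using Suc.prems by (simp add: m_assoc)
  qed
  have "(\<Sum>i<2*Suc k. of_bool (r = (s \<otimes> t) [^] i \<otimes> s) :: nat) =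
     of_bool (r = (s \<otimes> t) [^] (0::nat) \<otimes> s) + (of_bool (r = (s \<otimes> t) [^] Suc 0 \<otimes> s) +
       (\<Sum>i<2*k. of_bool (r = (s \<otimes> t) [^] Suc (Suc i) \<otimes> s)))"
    by (simp only: mult_Suc_right add_2_eq_Suc sum.lessThan_Suc_shift)
  also have "\<dots> = of_bool (r = s) + (of_bool (r = s \<otimes> t \<otimes> s) +
      (\<Sum>i<2*k. of_bool (r' = (s \<otimes> t) [^] i \<otimes> s)))"
    unfolding shift using Suc.prems by simp
  finally have "(\<Sum>i<2*Suc k. of_bool (r = (s \<otimes> t) [^] i \<otimes> s) :: nat) = \<dots>" .
  then show ?case using Suc.IH[of r'] Suc.prems one by (auto simp: r'_def)
qed auto

text \<open>As (st)^m = 1, the reflections (st)^i s have period m in i. A relator has 2m letters, so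
  it runs through two full periods and meets everything an even number of times.\<close>

lemma crosses_relator:
  assumes "w \<in> cox_relators G S" "r \<in> carrier G"
  shows "\<not> crosses G w r" "word_eval G w = \<one>" "set w \<subseteq> S"
proof -
  from assms obtain s t where st: "s \<in> S" "t \<in> S" and w: "w = concat (replicate (cox_m G s t) [s, t])"
    by (auto simp: cox_relators_def)
  define m where "m = cox_m G s t"
  have pow: "(s \<otimes> t) [^] m = \<one>"
    using st by (simp add: m_def cox_m_def pow_ord_eq_1)
  let ?f = "\<lambda>i. of_bool (r = (s \<otimes> t) [^] (i::nat) \<otimes> s) :: nat"
  have per: "?f (i + m) = ?f i" for i
    using st pow by (simp flip: nat_pow_mult)
  have "(\<Sum>i<2*m. ?f i) = (\<Sum>i<m. ?f i) + (\<Sum>i=m..<m+m. ?f i)"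
    by (simp add: mult_2 lessThan_atLeast0 sum.atLeastLessThan_concat del: sum_of_bool_eq)
  also have "(\<Sum>i=m..<m+m. ?f i) = (\<Sum>i<m. ?f (i + m))"
    using sum.shift_bounds_nat_ivl[of ?f 0 m m] by (simp add: lessThan_atLeast0)
  finally have "even (\<Sum>i<2*m. ?f i)" by (simp add: per)
  then show "\<not> crosses G w r" using crosses_dihedral[OF st assms(2)] by (simp add: w m_def)
  show ss: "set w \<subseteq> S" using st by (auto simp: w)
  have "word_eval G (concat (replicate k [s, t])) = (s \<otimes> t) [^] k" for k
    using st
  proof (induction k)
    case (Suc k)
    then show ?case by (subst nat_pow_Suc2) (auto simp: m_assoc)
  qed auto
  then show "word_eval G w = \<one>" by (simp add: w pow flip: m_def)
qed

text \<open>A relator has value 1, so the letters after it see \<open>r\<close> through the same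
  conjugation whether or not it is present. The disjunction in the hypothesis lets a step be used in
  both directions.\<close>

lemma crosses_step:
  assumes "(x, y) \<in> cox_step G S" "r \<in> carrier G" "set x \<subseteq> S \<or> set y \<subseteq> S"
  shows "set x \<subseteq> S \<and> set y \<subseteq> S \<and> crosses G x r = crosses G y r"
proof -
  from assms(1) obtain u w v where xy: "x = u @ w @ v" "y = u @ v" and w: "w \<in> cox_relators G S"
    by (auto simp: cox_step_def)
  have "set w \<subseteq> S" "word_eval G w = \<one>" using crosses_relator[OF w assms(2)] by auto
  moreover have "\<not> crosses G w (inv (word_eval G u) \<otimes> r \<otimes> word_eval G u)" if "set u \<subseteq> S"
    using that crosses_relator[OF w] assms(2) by simp
  ultimately show ?thesis using assms by (auto simp: xy crosses_append)
qed

lemma crosses_equiv: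
  assumes "(x, y) \<in> cox_equiv G S" "r \<in> carrier G" "set x \<subseteq> S"
  shows "set y \<subseteq> S \<and> crosses G x r = crosses G y r"
  using assms(1) unfolding cox_equiv_def
proof (induction)
  case base
  then show ?case using assms by simp
next
  case (step y z)
  then show ?case using crosses_step[of y z r] crosses_step[of z y r] assms(2) by auto
qed

lemma crosses_eval_one:
  assumes "set x \<subseteq> S" "word_eval G x = \<one>" "r \<in> carrier G"
  shows "\<not> crosses G x r"
proof -
  have "(x, []) \<in> cox_equiv G S" using coxeter assms by (auto simp: coxeter_system_def)
  from crosses_equiv[OF this assms(3,1)] show ?thesis by simp
qed

text \<open>Appending \<open>rev y\<close> to \<open>x\<close> and to \<open>y\<close> gives two
  words of value 1, both with even parity. The contribution of \<open>rev y\<close> is the same in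
  both, since it depends on the prefix only through its value.\<close>

lemma crosses_cong:
  assumes "set x \<subseteq> S" "set y \<subseteq> S" "word_eval G x = word_eval G y" "r \<in> carrier G"
  shows "crosses G x r = crosses G y r"
proof -
  have "\<not> crosses G (z @ rev y) r" if "set z \<subseteq> S" "word_eval G z = word_eval G y" for z
    using that assms by (intro crosses_eval_one) auto
  from this[of x] this[of y] show ?thesis using assms by (simp add: crosses_append)
qed

text \<open>A reflection met at the letter s_i is s_1 ... s_i ... s_1, and multiplying by it cancels
  exactly that letter. \<open>r\<close> is not restricted to generators because the induction
  conjugates it.\<close>

lemma crosses_delete:
  assumes "crosses G xs r" "set xs \<subseteq> S" "r \<in> carrier G"
  shows "\<exists>ys c zs. xs = ys @ c # zs \<and> r \<otimes> word_eval G xs = word_eval G (ys @ zs)"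
  using assms
proof (induction xs arbitrary: r)
  case (Cons c xs)
  show ?case
  proof (cases "r = c")
    case True
    then show ?thesis using Cons.prems by (intro exI[of _ "[]"]) auto
  next
    case False
    then have "crosses G xs (c \<otimes> r \<otimes> c)" using Cons.prems by simp
    from Cons.IH[OF this] Cons.prems obtain ys d zs where
      *: "xs = ys @ d # zs" "c \<otimes> r \<otimes> c \<otimes> word_eval G xs = word_eval G (ys @ zs)" by auto
    have "r \<otimes> (c \<otimes> word_eval G xs) = c \<otimes> (c \<otimes> r \<otimes> c \<otimes> word_eval G xs)"
      using Cons.prems by (simp add: m_assoc)
    then show ?thesis using * by (intro exI[of _ "c # ys"]) auto
  qed
qed auto

section \<open>Exchange, descents and folding\<close>

lemma crosses_shortens:
  assumes "crosses G xs s" "set xs \<subseteq> S" "s \<in> S"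
  shows "cox_length G S (s \<otimes> word_eval G xs) < cox_length G S (word_eval G xs)"
proof -
  \<comment> \<open>The parity depends only on the value of the word, so the letter can be deleted
    from a reduced word instead.\<close>
  obtain xs' where xs': "set xs' \<subseteq> S" "word_eval G xs' = word_eval G xs"
     "length xs' = cox_length G S (word_eval G xs)"
    using ex_reduced[of "word_eval G xs"] assms by auto
  then have "crosses G xs' s" using crosses_cong[of xs' xs s] assms by auto
  from crosses_delete[OF this] xs' assms obtain ys c zs where
    "xs' = ys @ c # zs" "s \<otimes> word_eval G xs' = word_eval G (ys @ zs)" by auto
  then show ?thesis using cox_length_le[of "ys @ zs"] xs' by auto
qed

lemma crosses_iff_shortens:
  assumes "set xs \<subseteq> S" "s \<in> S"
  shows "crosses G xs s \<longleftrightarrow>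
    cox_length G S (s \<otimes> word_eval G xs) < cox_length G S (word_eval G xs)"
    and "cox_length G S (s \<otimes> word_eval G xs) \<noteq> cox_length G S (word_eval G xs)"
proof -
  \<comment> \<open>Prepending \<open>s\<close> flips the parity at \<open>s\<close>, because
    conjugation by \<open>s\<close> fixes \<open>s\<close>. So \<open>s # xs\<close> crosses
    \<open>s\<close>, and the shortening leads from s x back to x.\<close>
  have "cox_length G S (word_eval G xs) < cox_length G S (s \<otimes> word_eval G xs)"
    if "\<not> crosses G xs s"
    using crosses_shortens[of "s # xs" s] assms that by auto
  then show "crosses G xs s \<longleftrightarrow>
    cox_length G S (s \<otimes> word_eval G xs) < cox_length G S (word_eval G xs)"
    and "cox_length G S (s \<otimes> word_eval G xs) \<noteq> cox_length G S (word_eval G xs)"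
    using crosses_shortens[of xs s] assms by fastforce+
qed

lemma cox_length_gen_mult:
  assumes "s \<in> S" "x \<in> carrier G"
  shows "cox_length G S (s \<otimes> x) = Suc (cox_length G S x) \<or>
    cox_length G S x = Suc (cox_length G S (s \<otimes> x))"
proof -
  obtain xs where "set xs \<subseteq> S" "word_eval G xs = x" using ex_word[OF assms(2)] by auto
  then have "cox_length G S (s \<otimes> x) \<noteq> cox_length G S x" using crosses_iff_shortens(2) assms by auto
  moreover have "cox_length G S (s \<otimes> x) \<le> Suc (cox_length G S x)"
    using assms by (rule cox_length_gen_mult_le)
  moreover have "cox_length G S x \<le> Suc (cox_length G S (s \<otimes> x))"
    using cox_length_gen_mult_le[of s "s \<otimes> x"] assms by simp
  ultimately show ?thesis by linarith
qed

lemma cox_length_mult_gen: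
  assumes "s \<in> S" "x \<in> carrier G"
  shows "cox_length G S (x \<otimes> s) = Suc (cox_length G S x) \<or>
    cox_length G S x = Suc (cox_length G S (x \<otimes> s))"
  using cox_length_gen_mult[of s "inv x"] cox_length_inv[of "x \<otimes> s"] cox_length_inv[of x] assms
  by (simp add: inv_mult_group)

lemma left_descent:
  assumes "x \<in> carrier G" "cox_length G S x > 0"
  shows "\<exists>s\<in>S. cox_length G S x = Suc (cox_length G S (s \<otimes> x))"
proof -
  obtain xs where xs: "set xs \<subseteq> S" "word_eval G xs = x" "length xs = cox_length G S x"
    using ex_reduced[OF assms(1)] .
  with assms obtain s ys where s: "xs = s # ys" by (cases xs) auto
  then have "s \<otimes> x = word_eval G ys" using xs by auto
  then have "cox_length G S (s \<otimes> x) < cox_length G S x"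
    using xs s cox_length_le[of ys] by auto
  then show ?thesis using cox_length_gen_mult[of s x] xs s assms by auto
qed

lemma right_descent:
  assumes "x \<in> carrier G" "cox_length G S x > 0"
  shows "\<exists>s\<in>S. cox_length G S x = Suc (cox_length G S (x \<otimes> s))"
proof -
  obtain s where "s \<in> S" "cox_length G S (inv x) = Suc (cox_length G S (s \<otimes> inv x))"
    using left_descent[of "inv x"] assms cox_length_inv by auto
  then show ?thesis using cox_length_inv[of "x \<otimes> s"] cox_length_inv[of x] assms
    by (auto simp: inv_mult_group)
qed

text \<open>The length hypotheses say that a word for \<open>x\<close> does not cross
  \<open>s\<close> but does so once \<open>t\<close> is appended. The crossing thus happens at the
  last letter, which means that x conjugates \<open>t\<close> to \<open>s\<close>.\<close>

lemma folding:
  assumes "s \<in> S" "t \<in> S" "x \<in> carrier G"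
    and "cox_length G S x < cox_length G S (s \<otimes> x)"
    and "cox_length G S (s \<otimes> x \<otimes> t) < cox_length G S (x \<otimes> t)"
  shows "s \<otimes> x = x \<otimes> t"
proof -
  obtain xs where xs: "set xs \<subseteq> S" "word_eval G xs = x" "length xs = cox_length G S x"
    using ex_reduced[OF assms(3)] .
  have "crosses G (xs @ [t]) s"
    using crosses_iff_shortens[of "xs @ [t]" s] xs assms by (auto simp: m_assoc)
  moreover have "\<not> crosses G xs s"
    using crosses_iff_shortens[of "xs" s] xs assms by auto
  ultimately have "crosses G [t] (inv x \<otimes> s \<otimes> x)"
    using xs assms by (subst (asm) crosses_append) auto
  then have "inv x \<otimes> s \<otimes> x = t" by simp
  then show ?thesis using assms by (auto simp: m_assoc inv_solve_left')
qed

end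

subsection \<open>The length on extended Coxeter groups\<close>

locale extended_coxeter_group = group W for W :: "'w monoid" (structure) +
  fixes Waff Omega S :: "'w set"
  assumes extended: "extended_coxeter W Waff Omega S"
begin

abbreviation "caff \<equiv> cox_length (W\<lparr>carrier := Waff\<rparr>) S"
abbreviation "len \<equiv> ext_length W Waff Omega S"

lemma subgroup_Waff: "subgroup Waff W" and subgroup_Omega: "subgroup Omega W"
  using extended by (auto simp: extended_coxeter_def normal_imp_subgroup)

sublocale aff: coxeter_group "W\<lparr>carrier := Waff\<rparr>" S
  using extended subgroup_Waff
  by (auto simp: coxeter_group_def coxeter_group_axioms_def extended_coxeter_def
      subgroup_imp_group)

lemma aff_closed [simp]: "w \<in> Waff \<Longrightarrow> w \<in> carrier W"
  by (rule subgroup.mem_carrier[OF subgroup_Waff])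

lemma Omega_closed [simp]: "u \<in> Omega \<Longrightarrow> u \<in> carrier W"
  by (rule subgroup.mem_carrier[OF subgroup_Omega])

lemma aff_mult [simp]: "v \<in> Waff \<Longrightarrow> w \<in> Waff \<Longrightarrow> v \<otimes> w \<in> Waff"
  and aff_inv [simp]: "v \<in> Waff \<Longrightarrow> inv v \<in> Waff"
  and Omega_mult [simp]: "x \<in> Omega \<Longrightarrow> y \<in> Omega \<Longrightarrow> x \<otimes> y \<in> Omega"
  and Omega_inv [simp]: "x \<in> Omega \<Longrightarrow> inv x \<in> Omega"
  and one_aff [simp]: "\<one> \<in> Waff"
  and one_Omega [simp]: "\<one> \<in> Omega"
  using subgroup_Waff subgroup_Omega
  by (auto simp: subgroup.m_closed subgroup.m_inv_closed subgroup.one_closed)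

lemma S_aff [simp]: "s \<in> S \<Longrightarrow> s \<in> Waff"
  using aff.gen_closed by simp

lemma S_square: "s \<in> S \<Longrightarrow> s \<otimes> s = \<one>"
  using aff.gen_square by simp

lemma S_inv: "s \<in> S \<Longrightarrow> inv s = s"
  by (rule inv_equality) (auto simp: S_square)

lemma conj_S: "u \<in> Omega \<Longrightarrow> s \<in> S \<Longrightarrow> u \<otimes> s \<otimes> inv u \<in> S"
  using extended by (auto simp: extended_coxeter_def)

lemma conj_S_inv: "u \<in> Omega \<Longrightarrow> s \<in> S \<Longrightarrow> inv u \<otimes> s \<otimes> u \<in> S"
  using conj_S[of "inv u" s] by simp

section \<open>The length read off from the affine factor\<close>

lemma decompose:
  assumes "x \<in> carrier W"
  obtains w u where "w \<in> Waff" "u \<in> Omega" "x = w \<otimes> u"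
proof -
  have "x \<in> Waff <#>\<^bsub>W\<^esub> Omega" using assms extended by (simp add: extended_coxeter_def)
  then show ?thesis using that by (auto simp: set_mult_def)
qed

text \<open>Two decompositions of the same element differ by an element of \<open>Waff\<close>
  \<inter> \<open>Omega\<close>, which is trivial. This justifies the definite description in
  \<open>ext_length\<close>.\<close>

lemma len_eq [simp]:
  assumes "w \<in> Waff" "u \<in> Omega"
  shows "len (w \<otimes> u) = caff w"
  unfolding ext_length_def
proof (rule the_equality)
  fix k assume "\<exists>v\<in>Waff. \<exists>u'\<in>Omega. w \<otimes> u = v \<otimes> u' \<and> k = caff v"
  then obtain v u' where v: "v \<in> Waff" "u' \<in> Omega" "w \<otimes> u = v \<otimes> u'" "k = caff v" by auto
  have "inv v \<otimes> w = inv v \<otimes> (w \<otimes> u) \<otimes> inv u" using v(1) assms by (simp add: m_assoc)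
  also have "\<dots> = u' \<otimes> inv u" using v(1,2) assms by (simp add: v(3) flip: m_assoc)
  finally have "inv v \<otimes> w = u' \<otimes> inv u" .
  moreover have "inv v \<otimes> w \<in> Waff" "u' \<otimes> inv u \<in> Omega" using v assms by auto
  ultimately have "inv v \<otimes> w \<in> Waff \<inter> Omega" by auto
  then have "inv v \<otimes> w = \<one>" using extended by (auto simp: extended_coxeter_def)
  then have "v = w" using v assms by (metis aff_closed inv_closed inv_equality inv_inv)
  then show "k = caff w" using v by simp
qed (use assms in auto)

lemma len_one: "len \<one> = 0"
  using len_eq[of \<one> \<one>] aff.cox_length_one by simp

lemma len_eq_0:
  assumes "x \<in> carrier W" "len x = 0"
  shows "x \<in> Omega"
proof (rule decompose[OF assms(1)])
  fix w u assume *: "w \<in> Waff" "u \<in> Omega" "x = w \<otimes> u"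
  then have "w = \<one>" using assms aff.cox_length_eq_0[of w] by simp
  then show ?thesis using * by simp
qed

lemma len_mult_Omega:
  assumes "x \<in> carrier W" "u \<in> Omega"
  shows "len (x \<otimes> u) = len x"
  using assms by (auto elim!: decompose simp: m_assoc)

text \<open>Conjugation by \<open>u\<close> maps \<open>S\<close> into itself, so it can be applied
  to a reduced word letter by letter. The same bound for \<open>inv u\<close> later gives
  equality.\<close>

lemma caff_conj_le:
  assumes "w \<in> Waff" "u \<in> Omega"
  shows "u \<otimes> w \<otimes> inv u \<in> Waff \<and> caff (u \<otimes> w \<otimes> inv u) \<le> caff w"
proof -
  obtain xs where xs: "set xs \<subseteq> S" "word_eval (W\<lparr>carrier := Waff\<rparr>) xs = w" "length xs = caff w"
    using aff.ex_reduced[of w] assms by auto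
  let ?xs = "map (\<lambda>s. u \<otimes> s \<otimes> inv u) xs"
  have "set ?xs \<subseteq> S" using xs(1) conj_S assms by auto
  moreover have "word_eval (W\<lparr>carrier := Waff\<rparr>) (map (\<lambda>s. u \<otimes> s \<otimes> inv u) ys) =
      u \<otimes> word_eval (W\<lparr>carrier := Waff\<rparr>) ys \<otimes> inv u" if "set ys \<subseteq> S" for ys
    using that
  proof (induction ys)
    case Nil
    then show ?case using assms by simp
  next
    case (Cons y ys)
    have "word_eval (W\<lparr>carrier := Waff\<rparr>) ys \<in> Waff" using aff.eval_closed[of ys] Cons.prems by simp
    moreover have "inv u \<otimes> (u \<otimes> z) = z" if "z \<in> carrier W" for z
      using that assms by (simp flip: m_assoc)
    ultimately show ?case using Cons assms by (simp add: m_assoc)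
  qed
  ultimately show ?thesis using aff.cox_length_le[of ?xs] aff.eval_closed[of ?xs] xs by simp
qed

lemma caff_conj:
  assumes "w \<in> Waff" "u \<in> Omega"
  shows "caff (u \<otimes> w \<otimes> inv u) = caff w"
proof -
  have "inv u \<otimes> (u \<otimes> w \<otimes> inv u) \<otimes> u = w"
    using assms by (metis Omega_closed aff_closed inv_closed inv_solve_left inv_solve_right
        inv_inv m_assoc m_closed)
  then show ?thesis
    using caff_conj_le[OF assms] caff_conj_le[of "u \<otimes> w \<otimes> inv u" "inv u"] assms by auto
qed

lemma len_Omega_mult:
  assumes "x \<in> carrier W" "u \<in> Omega"
  shows "len (u \<otimes> x) = len x"
proof (rule decompose[OF assms(1)])
  fix w v assume *: "w \<in> Waff" "v \<in> Omega" "x = w \<otimes> v"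
  then have "u \<otimes> x = (u \<otimes> w \<otimes> inv u) \<otimes> (u \<otimes> v)"
    using assms(2) by (simp add: m_assoc inv_solve_left)
  then show ?thesis using * caff_conj_le[of w u] caff_conj[of w u] assms(2) by simp
qed

text \<open>Moving \<open>t\<close> past \<open>u\<close> turns it into another generator, so right
  multiplication by a generator acts on the affine factor alone.\<close>

lemma mult_gen_decompose:
  assumes "w \<in> Waff" "u \<in> Omega" "t \<in> S"
  shows "w \<otimes> u \<otimes> t = w \<otimes> (u \<otimes> t \<otimes> inv u) \<otimes> u"
  using assms by (simp add: m_assoc)

section \<open>Generators, descents and folding in the extended group\<close>

lemma len_gen_mult:
  assumes "s \<in> S" "x \<in> carrier W"
  shows "len (s \<otimes> x) = Suc (len x) \<or> len x = Suc (len (s \<otimes> x))"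
proof (rule decompose[OF assms(2)])
  fix w u assume "w \<in> Waff" "u \<in> Omega" "x = w \<otimes> u"
  then show ?thesis using aff.cox_length_gen_mult[of s w] assms by (simp flip: m_assoc)
qed

lemma len_mult_gen:
  assumes "t \<in> S" "x \<in> carrier W"
  shows "len (x \<otimes> t) = Suc (len x) \<or> len x = Suc (len (x \<otimes> t))"
proof (rule decompose[OF assms(2)])
  fix w u assume "w \<in> Waff" "u \<in> Omega" "x = w \<otimes> u"
  then show ?thesis using aff.cox_length_mult_gen[of "u \<otimes> t \<otimes> inv u" w] assms conj_S[of u t]
    by (simp add: mult_gen_decompose)
qed

lemma len_left_descent:
  assumes "x \<in> carrier W" "len x > 0"
  shows "\<exists>s\<in>S. len x = Suc (len (s \<otimes> x))"
proof (rule decompose[OF assms(1)])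
  fix w u assume "w \<in> Waff" "u \<in> Omega" "x = w \<otimes> u"
  then show ?thesis using aff.left_descent[of w] assms by (auto simp flip: m_assoc)
qed

lemma len_right_descent:
  assumes "x \<in> carrier W" "len x > 0"
  shows "\<exists>s\<in>S. len x = Suc (len (x \<otimes> s))"
proof (rule decompose[OF assms(1)])
  fix w u assume *: "w \<in> Waff" "u \<in> Omega" "x = w \<otimes> u"
  then obtain s where s: "s \<in> S" "caff w = Suc (caff (w \<otimes> s))"
    using aff.right_descent[of w] assms by auto
  \<comment> \<open>The right descent \<open>s\<close> of the affine factor becomes a right descent
    of x = w u after conjugation by \<open>inv u\<close>.\<close>
  have "x \<otimes> (inv u \<otimes> s \<otimes> u) = w \<otimes> s \<otimes> u"
  proof -
    have "u \<otimes> (inv u \<otimes> (s \<otimes> u)) = s \<otimes> u" using * s by (simp flip: m_assoc)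
    then show ?thesis using * s by (simp add: m_assoc)
  qed
  then show ?thesis using * s conj_S_inv[of u s] by (intro bexI[of _ "inv u \<otimes> s \<otimes> u"]) auto
qed

text \<open>The affine version has to know which of w and s w is shorter. The hypotheses here are
  symmetric in the two, and the descending case is the ascending one for s w.\<close>

lemma len_folding:
  assumes "s \<in> S" "t \<in> S" "x \<in> carrier W"
    and "len (s \<otimes> x) = len (x \<otimes> t)" "len (s \<otimes> x \<otimes> t) = len x"
  shows "s \<otimes> x = x \<otimes> t"
proof (rule decompose[OF assms(3)])
  fix w u assume *: "w \<in> Waff" "u \<in> Omega" "x = w \<otimes> u"
  define t' where "t' = u \<otimes> t \<otimes> inv u"
  have t': "t' \<in> S" using * assms conj_S by (simp add: t'_def)
  have xt: "x \<otimes> t = w \<otimes> t' \<otimes> u"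
    using * assms by (simp add: mult_gen_decompose t'_def)
  have sx: "s \<otimes> x = s \<otimes> w \<otimes> u" using * assms by (simp add: m_assoc)
  have sxt: "s \<otimes> x \<otimes> t = s \<otimes> w \<otimes> t' \<otimes> u"
    using * assms xt t' by (simp add: m_assoc)
  have len: "caff (s \<otimes> w) = caff (w \<otimes> t')" "caff (s \<otimes> w \<otimes> t') = caff w"
    using assms(4,5)[unfolded sxt] assms(4)[unfolded xt sx] * t' assms(1) by auto
  have "s \<otimes> w = w \<otimes> t'"
  proof (cases "caff w < caff (s \<otimes> w)")
    case True
    then show ?thesis using aff.folding[of s t' w] len * t' assms(1) by simp
  next
    case False
    then have "caff (s \<otimes> w) < caff w" using aff.cox_length_gen_mult[of s w] * assms(1) by auto
    then have "s \<otimes> (s \<otimes> w) = (s \<otimes> w) \<otimes> t'"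
      using aff.folding[of s t' "s \<otimes> w"] len * t' assms(1) S_square
      by (simp flip: m_assoc)
    then have "s \<otimes> (s \<otimes> w) \<otimes> t' = s \<otimes> w"
      using aff.gen_cancel_right[of t' "s \<otimes> w"] * t' assms(1) by simp
    then show ?thesis using aff.gen_cancel[of s w] * assms(1) by simp
  qed
  then show ?thesis using xt sx by simp
qed

end

subsection \<open>Free modules and convolution\<close>

text \<open>The product g * f in the group ring. As in \<open>conv\<close>, the sum runs over the
  support of the first argument \<open>f\<close>; the map is therefore linear in \<open>g\<close> on
  all functions, finitely supported or not.\<close>

definition right_conv ::
  "('g, 'b) monoid_scheme \<Rightarrow> ('g \<Rightarrow> 'r::comm_ring_1) \<Rightarrow> ('g \<Rightarrow> 'r) \<Rightarrow> 'g \<Rightarrow> 'r" where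
  "right_conv G f g =
    (\<lambda>x. if x \<in> carrier G then (\<Sum>y\<in>fsupp f. f y * g (x \<otimes>\<^bsub>G\<^esub> inv\<^bsub>G\<^esub> y)) else 0)"

section \<open>Linear maps on functions and the free module\<close>

interpretation fun_module: Modules.module "smult_fun :: 'r::comm_ring_1 \<Rightarrow> ('g \<Rightarrow> 'r) \<Rightarrow> 'g \<Rightarrow> 'r"
  by unfold_locales (auto simp: smult_fun_def algebra_simps)

interpretation fun_pair: module_pair
  "smult_fun :: 'r::comm_ring_1 \<Rightarrow> ('g \<Rightarrow> 'r) \<Rightarrow> 'g \<Rightarrow> 'r"
  "smult_fun :: 'r::comm_ring_1 \<Rightarrow> ('g \<Rightarrow> 'r) \<Rightarrow> 'g \<Rightarrow> 'r" ..

abbreviation fun_hom :: "(('g \<Rightarrow> 'r::comm_ring_1) \<Rightarrow> ('g \<Rightarrow> 'r)) \<Rightarrow> bool" where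
  "fun_hom \<equiv> module_hom smult_fun smult_fun"

lemma fun_homI:
  "(\<And>x y. L (x + y) = L x + L y) \<Longrightarrow> (\<And>c x. L (smult_fun c x) = smult_fun c (L x)) \<Longrightarrow> fun_hom L"
  by unfold_locales auto

lemma fun_hom_add: "fun_hom L \<Longrightarrow> L (x + y) = L x + L y"
  using module_hom.add[of smult_fun smult_fun L] .

lemma fun_hom_smult: "fun_hom L \<Longrightarrow> L (smult_fun c x) = smult_fun c (L x)"
  using module_hom.scale[of smult_fun smult_fun L] .

lemma fsupp_basis_el [simp]: "fsupp (basis_el w :: 'g \<Rightarrow> 'r::comm_ring_1) = {w}"
  by (auto simp: fsupp_def basis_el_def)

lemma basis_el_in_free_mod [simp]: "(basis_el w :: 'g \<Rightarrow> 'r::comm_ring_1) \<in> free_mod A \<longleftrightarrow> w \<in> A"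
  by (auto simp: free_mod_def)

lemma subspace_free_mod: "fun_module.subspace (free_mod A :: ('a \<Rightarrow> 'b::comm_ring_1) set)"
proof (rule fun_module.subspaceI)
  show "(0::'a \<Rightarrow> 'b) \<in> free_mod A" by (simp add: free_mod_def fsupp_def)
next
  fix x y :: "'a \<Rightarrow> 'b" assume *: "x \<in> free_mod A" "y \<in> free_mod A"
  have "fsupp (x + y) \<subseteq> fsupp x \<union> fsupp y" by (auto simp: fsupp_def)
  from finite_subset[OF this] this show "x + y \<in> free_mod A" using * by (auto simp: free_mod_def)
next
  fix c and x :: "'a \<Rightarrow> 'b" assume *: "x \<in> free_mod A"
  have "fsupp (smult_fun c x) \<subseteq> fsupp x" by (auto simp: fsupp_def smult_fun_def)
  from finite_subset[OF this] this show "smult_fun c x \<in> free_mod A" using * by (auto simp: free_mod_def)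
qed

lemma free_mod_span: "fun_module.span (basis_el ` A) = (free_mod A :: ('g \<Rightarrow> 'r::comm_ring_1) set)"
proof (rule fun_module.span_subspace[OF _ _ subspace_free_mod])
  show "basis_el ` A \<subseteq> (free_mod A :: ('g \<Rightarrow> 'r) set)" by auto
  show "free_mod A \<subseteq> fun_module.span (basis_el ` A :: ('g \<Rightarrow> 'r) set)"
  proof
    fix f :: "'g \<Rightarrow> 'r" assume f: "f \<in> free_mod A"
    then have fin: "finite (fsupp f)" by (simp add: free_mod_def)
    have "f = (\<Sum>w\<in>fsupp f. smult_fun (f w) (basis_el w))"
    proof
      fix v
      have "(\<Sum>w\<in>F. smult_fun (f w) (basis_el w)) v = (\<Sum>w\<in>F. smult_fun (f w) (basis_el w) v)" for F
        by (induction F rule: infinite_finite_induct) auto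
      also have "(\<Sum>w\<in>fsupp f. smult_fun (f w) (basis_el w) v) = (\<Sum>w\<in>fsupp f. if v = w then f w else 0)"
        by (intro sum.cong) (auto simp: smult_fun_def basis_el_def)
      also have "\<dots> = f v" using fin by (auto simp: fsupp_def)
      finally show "f v = (\<Sum>w\<in>fsupp f. smult_fun (f w) (basis_el w)) v" by simp
    qed
    also have "\<dots> \<in> fun_module.span (basis_el ` A)"
      using f by (intro fun_module.span_sum fun_module.span_scale fun_module.span_base)
        (auto simp: free_mod_def)
    finally show "f \<in> fun_module.span (basis_el ` A)" .
  qed
qed

lemma free_mod_add: "x \<in> free_mod A \<Longrightarrow> y \<in> free_mod A \<Longrightarrow> x + y \<in> free_mod A"
  for x y :: "'g \<Rightarrow> 'r::comm_ring_1"
  by (rule fun_module.subspace_add[OF subspace_free_mod])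

lemma free_mod_smult: "x \<in> free_mod A \<Longrightarrow> smult_fun c x \<in> free_mod A"
  for x :: "'g \<Rightarrow> 'r::comm_ring_1"
  by (rule fun_module.subspace_scale[OF subspace_free_mod])

lemma free_mod_mono: "x \<in> free_mod A \<Longrightarrow> A \<subseteq> B \<Longrightarrow> x \<in> free_mod B"
  by (auto simp: free_mod_def)

lemma free_mod_induct [consumes 1, case_names basis zero add smult]:
  fixes x :: "'g \<Rightarrow> 'r::comm_ring_1"
  assumes "x \<in> free_mod A"
    and "\<And>w. w \<in> A \<Longrightarrow> P (basis_el w)" "P 0"
    and "\<And>x y. x \<in> free_mod A \<Longrightarrow> y \<in> free_mod A \<Longrightarrow> P x \<Longrightarrow> P y \<Longrightarrow> P (x + y)"
    and "\<And>c x. x \<in> free_mod A \<Longrightarrow> P x \<Longrightarrow> P (smult_fun c x)"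
  shows "P x"
proof -
  have "x \<in> free_mod A \<and> P x"
    using assms(1)[folded free_mod_span]
  proof (rule fun_module.span_induct)
    show "fun_module.subspace {x. x \<in> free_mod A \<and> P x}"
      using assms(3-5) fun_module.subspace_0[OF subspace_free_mod]
      by (auto intro!: fun_module.subspaceI intro: free_mod_add free_mod_smult)
  qed (use assms(2) in auto)
  then show ?thesis ..
qed

lemma fun_hom_eq_on_free_mod:
  assumes "fun_hom L" "fun_hom L'" "\<And>w. w \<in> A \<Longrightarrow> L (basis_el w) = L' (basis_el w)" "x \<in> free_mod A"
  shows "L x = L' x"
  using fun_pair.module_hom_eq_on_span[OF assms(1,2), of "basis_el ` A" x] assms(3,4)
  by (auto simp: free_mod_span)

lemma fun_hom_free_mod:
  assumes "fun_hom L" "\<And>w. w \<in> A \<Longrightarrow> L (basis_el w) \<in> free_mod B" "x \<in> free_mod A"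
  shows "L x \<in> free_mod B"
  using assms(3) assms(2)
  by (induction rule: free_mod_induct)
    (auto simp: module_hom.zero[OF assms(1)] fun_hom_add[OF assms(1)] fun_hom_smult[OF assms(1)]
      fun_module.subspace_0[OF subspace_free_mod] intro: free_mod_add free_mod_smult)

text \<open>Pointwise multiplication is an operator that is diagonal in the basis. Case distinctions
  on the length of \<open>w\<close> are encoded by such operators, which keeps them linear.\<close>

lemma times_basis_el: "c * basis_el w = smult_fun (c w) (basis_el w)" for c :: "'g \<Rightarrow> 'r::comm_ring_1"
  by (auto simp: smult_fun_def basis_el_def)

lemma fun_hom_times: "fun_hom ((*) c)" for c :: "'g \<Rightarrow> 'r::comm_ring_1"
  by (rule fun_homI) (auto simp: smult_fun_def algebra_simps)

lemma fun_hom_conv: "fun_hom (conv G f)"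
  by (rule fun_homI) (auto simp: conv_def smult_fun_def sum.distrib sum_distrib_left algebra_simps)

lemma fun_hom_right_conv: "fun_hom (right_conv G f)"
  by (rule fun_homI)
    (auto simp: right_conv_def smult_fun_def sum.distrib sum_distrib_left algebra_simps)

section \<open>Left and right convolution over a group\<close>

context group
begin

lemma conv_basis_el_apply:
  assumes "f \<in> free_mod (carrier G)" "w \<in> carrier G" "v \<in> carrier G"
  shows "conv G f (basis_el w) v = f (v \<otimes> inv w)"
proof -
  have "inv y \<otimes> v = w \<longleftrightarrow> v \<otimes> inv w = y" if "y \<in> carrier G" for y
    using that assms(2,3) by (metis inv_closed inv_inv inv_solve_left inv_solve_right m_closed)
  then have "conv G f (basis_el w) v = (\<Sum>y\<in>fsupp f. if v \<otimes> inv w = y then f y else 0)"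
    unfolding conv_def basis_el_def using assms
    by (auto simp: free_mod_def subset_iff if_distrib cong: sum.cong if_cong)
  also have "\<dots> = f (v \<otimes> inv w)" using assms by (auto simp: free_mod_def fsupp_def)
  finally show ?thesis .
qed

lemma right_conv_basis_el_apply:
  assumes "f \<in> free_mod (carrier G)" "w \<in> carrier G" "v \<in> carrier G"
  shows "right_conv G f (basis_el w) v = f (inv w \<otimes> v)"
proof -
  have "v \<otimes> inv y = w \<longleftrightarrow> inv w \<otimes> v = y" if "y \<in> carrier G" for y
    using that assms(2,3) by (metis inv_closed inv_inv inv_solve_left inv_solve_right m_closed)
  then have "right_conv G f (basis_el w) v = (\<Sum>y\<in>fsupp f. if inv w \<otimes> v = y then f y else 0)"
    unfolding right_conv_def basis_el_def using assms
    by (auto simp: free_mod_def subset_iff if_distrib cong: sum.cong if_cong)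
  also have "\<dots> = f (inv w \<otimes> v)" using assms by (auto simp: free_mod_def fsupp_def)
  finally show ?thesis .
qed

lemma conv_basis_el_eq:
  assumes "f \<in> free_mod (carrier G)" "w \<in> carrier G"
  shows "conv G f (basis_el w) = (\<lambda>v. if v \<in> carrier G then f (v \<otimes> inv w) else 0)"
  using assms conv_basis_el_apply by (auto simp: fun_eq_iff) (simp add: conv_def)

lemma right_conv_basis_el_eq:
  assumes "f \<in> free_mod (carrier G)" "w \<in> carrier G"
  shows "right_conv G f (basis_el w) = (\<lambda>v. if v \<in> carrier G then f (inv w \<otimes> v) else 0)"
  using assms right_conv_basis_el_apply by (auto simp: fun_eq_iff) (simp add: right_conv_def)

lemma conv_basis_el [simp]:
  assumes "g \<in> carrier G" "w \<in> carrier G"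
  shows "conv G (basis_el g) (basis_el w) = (basis_el (g \<otimes> w) :: _ \<Rightarrow> 'r::comm_ring_1)"
proof
  fix v
  show "conv G (basis_el g) (basis_el w) v = (basis_el (g \<otimes> w) v :: 'r)"
  proof (cases "v \<in> carrier G")
    case True
    then have "v \<otimes> inv w = g \<longleftrightarrow> v = g \<otimes> w" using assms by (metis inv_solve_right)
    then show ?thesis using True assms
      by (simp add: conv_basis_el_apply) (simp add: basis_el_def)
  qed (use assms in \<open>auto simp: conv_def basis_el_def\<close>)
qed

lemma right_conv_basis_el [simp]:
  assumes "g \<in> carrier G" "w \<in> carrier G"
  shows "right_conv G (basis_el g) (basis_el w) = (basis_el (w \<otimes> g) :: _ \<Rightarrow> 'r::comm_ring_1)"
proof
  fix v
  show "right_conv G (basis_el g) (basis_el w) v = (basis_el (w \<otimes> g) v :: 'r)"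
  proof (cases "v \<in> carrier G")
    case True
    then have "inv w \<otimes> v = g \<longleftrightarrow> v = w \<otimes> g" using assms by (metis inv_solve_left)
    then show ?thesis using True assms
      by (simp add: right_conv_basis_el_apply) (simp add: basis_el_def)
  qed (use assms in \<open>auto simp: right_conv_def basis_el_def\<close>)
qed

lemma conv_free_mod:
  assumes "f \<in> free_mod (carrier G)" "x \<in> free_mod (carrier G)"
  shows "conv G f x \<in> free_mod (carrier G)"
proof (rule fun_hom_free_mod[OF fun_hom_conv _ assms(2)])
  fix w assume w: "w \<in> carrier G"
  have "fsupp (conv G f (basis_el w)) \<subseteq> (\<lambda>y. y \<otimes> w) ` fsupp f \<inter> carrier G"
  proof
    fix v assume v: "v \<in> fsupp (conv G f (basis_el w))"
    then have "v \<in> carrier G" by (auto simp: fsupp_def conv_def split: if_splits)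
    moreover from this v have "v \<otimes> inv w \<in> fsupp f"
      using assms w by (auto simp: fsupp_def conv_basis_el_apply)
    moreover have "v = v \<otimes> inv w \<otimes> w" using \<open>v \<in> carrier G\<close> w by (simp add: m_assoc)
    ultimately show "v \<in> (\<lambda>y. y \<otimes> w) ` fsupp f \<inter> carrier G" by blast
  qed
  then show "conv G f (basis_el w) \<in> free_mod (carrier G)"
    using assms(1) by (auto simp: free_mod_def intro: finite_subset)
qed

lemma right_conv_one:
  assumes "f \<in> free_mod (carrier G)"
  shows "right_conv G f (basis_el \<one>) = f"
proof
  fix v show "right_conv G f (basis_el \<one>) v = f v"
    using assms by (cases "v \<in> carrier G")
      (auto simp: right_conv_basis_el_apply, auto simp: right_conv_def free_mod_def fsupp_def)
qed

text \<open>Associativity of the product in the group ring. Both sums are finite because of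
  \<open>f\<close> and \<open>g\<close>, so \<open>x\<close> may be any function.\<close>

lemma conv_right_conv:
  assumes "f \<in> free_mod (carrier G)" "g \<in> free_mod (carrier G)"
  shows "conv G f (right_conv G g x) = right_conv G g (conv G f x)"
proof
  fix v
  have "(\<Sum>y\<in>fsupp f. \<Sum>z\<in>fsupp g. f y * (g z * x (inv y \<otimes> v \<otimes> inv z))) =
    (\<Sum>z\<in>fsupp g. \<Sum>y\<in>fsupp f. g z * (f y * x (inv y \<otimes> (v \<otimes> inv z))))" if "v \<in> carrier G"
    using assms that by (subst sum.swap, intro sum.cong refl)
      (auto simp: free_mod_def subset_iff m_assoc mult.left_commute)
  then show "conv G f (right_conv G g x) v = right_conv G g (conv G f x) v"
    using assms by (auto simp: conv_def right_conv_def sum_distrib_left free_mod_def subset_iff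
      cong: sum.cong)
qed

text \<open>Translation by \<open>A\<close> does not change the eigenvalues \<open>c\<close>, so the
  diagonal operator passes through convolution. In the application \<open>A\<close> consists of
  length-zero elements and \<open>c\<close> compares lengths.\<close>

lemma conv_times:
  assumes "f \<in> free_mod A" "A \<subseteq> carrier G"
    and "\<And>y v. y \<in> A \<Longrightarrow> v \<in> carrier G \<Longrightarrow> c (inv y \<otimes> v) = c v"
  shows "conv G f (c * x) = c * conv G f x"
  using assms
  by (auto simp: conv_def fun_eq_iff free_mod_def subset_iff sum_distrib_left mult.left_commute
      intro!: sum.cong)

lemma right_conv_times:
  assumes "f \<in> free_mod A" "A \<subseteq> carrier G"
    and "\<And>y v. y \<in> A \<Longrightarrow> v \<in> carrier G \<Longrightarrow> c (v \<otimes> inv y) = c v"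
  shows "right_conv G f (c * x) = c * right_conv G f x"
  using assms
  by (auto simp: right_conv_def fun_eq_iff free_mod_def subset_iff sum_distrib_left mult.left_commute
      intro!: sum.cong)

end

subsection \<open>The generic algebra of a group with a length function\<close>

text \<open>As rewrite rules these two would also turn the unapplied terms \<open>f + g\<close> and \<open>0\<close> into abstractions.\<close>

declare plus_fun_apply [simp del] zero_fun_apply [simp del]

text \<open>The conclusion of \<open>folding\<close> says $a_s = a_t$ and $b_s\, T_{w n_t} = T_{n_s w}\, b_t$, coefficientwise.\<close>

locale hecke_datum = group G for G :: "'g monoid" (structure) +
  fixes S :: "'s set" and n :: "'s \<Rightarrow> 'g" and T :: "'g set" and len :: "'g \<Rightarrow> nat"
    and a :: "'s \<Rightarrow> 'r::comm_ring_1" and b :: "'s \<Rightarrow> 'g \<Rightarrow> 'r"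
  assumes n_closed [simp]: "s \<in> S \<Longrightarrow> n s \<in> carrier G"
    and T_closed: "T \<subseteq> carrier G"
    and b_closed: "s \<in> S \<Longrightarrow> b s \<in> free_mod T"
    and len_T: "x \<in> T \<Longrightarrow> len x = 0"
    and len_one: "len \<one> = 0"
    and len_square: "s \<in> S \<Longrightarrow> len (n s \<otimes> n s) = 0"
    and len_null_mult: "u \<in> carrier G \<Longrightarrow> len u = 0 \<Longrightarrow> w \<in> carrier G \<Longrightarrow> len (u \<otimes> w) = len w"
    and len_mult_null: "u \<in> carrier G \<Longrightarrow> len u = 0 \<Longrightarrow> w \<in> carrier G \<Longrightarrow> len (w \<otimes> u) = len w"
    and len_left: "s \<in> S \<Longrightarrow> w \<in> carrier G \<Longrightarrow>
      len (n s \<otimes> w) = Suc (len w) \<or> len w = Suc (len (n s \<otimes> w))"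
    and len_right: "s \<in> S \<Longrightarrow> w \<in> carrier G \<Longrightarrow>
      len (w \<otimes> n s) = Suc (len w) \<or> len w = Suc (len (w \<otimes> n s))"
    and left_descent: "w \<in> carrier G \<Longrightarrow> len w > 0 \<Longrightarrow>
      \<exists>s\<in>S. \<exists>v\<in>carrier G. w = n s \<otimes> v \<and> len w = Suc (len v)"
    and right_descent: "w \<in> carrier G \<Longrightarrow> len w > 0 \<Longrightarrow>
      \<exists>s\<in>S. \<exists>v\<in>carrier G. w = v \<otimes> n s \<and> len w = Suc (len v)"
    and folding: "s \<in> S \<Longrightarrow> t \<in> S \<Longrightarrow> w \<in> carrier G \<Longrightarrow> len (n s \<otimes> w) = len (w \<otimes> n t) \<Longrightarrow>
      len (n s \<otimes> w \<otimes> n t) = len w \<Longrightarrow>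
      a s = a t \<and> (\<forall>v\<in>carrier G. b s (v \<otimes> inv (w \<otimes> n t)) = b t (inv (n s \<otimes> w) \<otimes> v))"
begin

abbreviation "M \<equiv> (free_mod (carrier G) :: ('g \<Rightarrow> 'r) set)"
abbreviation "null \<equiv> {u \<in> carrier G. len u = 0}"

section \<open>Length-zero elements and subadditivity\<close>

lemma b_null: "s \<in> S \<Longrightarrow> b s \<in> free_mod null"
  using b_closed[of s] T_closed len_T by (auto intro: free_mod_mono)

lemma null_in_M: "f \<in> free_mod null \<Longrightarrow> f \<in> M"
  by (auto intro: free_mod_mono)

lemma b_in_M [simp]: "s \<in> S \<Longrightarrow> b s \<in> M"
  using b_null null_in_M by blast

lemma len_n: "s \<in> S \<Longrightarrow> len (n s) = 1"
  using len_left[of s \<one>] by (simp add: len_one)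

lemma len_null_inv_mult: "u \<in> null \<Longrightarrow> w \<in> carrier G \<Longrightarrow> len (inv u \<otimes> w) = len w"
  using len_null_mult[of u "inv u \<otimes> w"] by (simp flip: m_assoc)

lemma len_mult_null_inv: "u \<in> null \<Longrightarrow> w \<in> carrier G \<Longrightarrow> len (w \<otimes> inv u) = len w"
  using len_mult_null[of u "w \<otimes> inv u"] by (simp add: m_assoc)

lemma len_subadd:
  assumes "w \<in> carrier G" "w' \<in> carrier G"
  shows "len (w \<otimes> w') \<le> len w + len w'"
  using assms(1)
proof (induction "len w" arbitrary: w)
  case 0
  then show ?case using assms by (simp add: len_null_mult)
next
  case (Suc k)
  then obtain s v where s: "s \<in> S" "v \<in> carrier G" "w = n s \<otimes> v" "len w = Suc (len v)"
    using left_descent[of w] by auto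
  then have "len (v \<otimes> w') \<le> len v + len w'" using Suc by auto
  then show ?case using s len_left[of s "v \<otimes> w'"] assms by (auto simp: m_assoc)
qed

section \<open>The forced operators of left and right multiplication\<close>

definition left_op :: "'s \<Rightarrow> ('g \<Rightarrow> 'r) \<Rightarrow> 'g \<Rightarrow> 'r" where
  "left_op s x = conv G (basis_el (n s)) ((\<lambda>w. if len w < len (n s \<otimes> w) then 1 else a s) * x) +
     conv G (b s) ((\<lambda>w. if len w < len (n s \<otimes> w) then 0 else 1) * x)"

definition right_op :: "'s \<Rightarrow> ('g \<Rightarrow> 'r) \<Rightarrow> 'g \<Rightarrow> 'r" where
  "right_op t x = right_conv G (basis_el (n t)) ((\<lambda>w. if len w < len (w \<otimes> n t) then 1 else a t) * x) +
     right_conv G (b t) ((\<lambda>w. if len w < len (w \<otimes> n t) then 0 else 1) * x)"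

lemma fun_hom_left_op: "fun_hom (left_op s)"
  unfolding left_op_def
  by (intro fun_pair.module_hom_add
      module_hom_compose[OF fun_hom_times fun_hom_conv, unfolded comp_def])

lemma fun_hom_right_op: "fun_hom (right_op s)"
  unfolding right_op_def
  by (intro fun_pair.module_hom_add
      module_hom_compose[OF fun_hom_times fun_hom_right_conv, unfolded comp_def])

lemmas op_linear =
  fun_hom_add[OF fun_hom_left_op] fun_hom_smult[OF fun_hom_left_op]
  fun_hom_add[OF fun_hom_right_op] fun_hom_smult[OF fun_hom_right_op]
  fun_hom_add[OF fun_hom_conv] fun_hom_smult[OF fun_hom_conv]
  fun_hom_add[OF fun_hom_right_conv] fun_hom_smult[OF fun_hom_right_conv]

text \<open>The second branch is forced as follows: if w = n_s v with v shorter, then T_{n_s} T_w =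
  T_{n_s}^2 T_v, and T_{n_s}^2 = a_s T_{n_s^2} + b_s T_{n_s} once b_s is known to commute with
  T_{n_s}.\<close>

lemma left_op_basis_el:
  assumes "s \<in> S" "w \<in> carrier G"
  shows "left_op s (basis_el w) =
    (if len w < len (n s \<otimes> w) then basis_el (n s \<otimes> w)
     else smult_fun (a s) (basis_el (n s \<otimes> w)) + conv G (b s) (basis_el w))"
  using assms
  by (simp add: left_op_def times_basis_el op_linear module_hom.zero[OF fun_hom_conv])

lemma right_op_basis_el:
  assumes "s \<in> S" "w \<in> carrier G"
  shows "right_op s (basis_el w) =
    (if len w < len (w \<otimes> n s) then basis_el (w \<otimes> n s)
     else smult_fun (a s) (basis_el (w \<otimes> n s)) + right_conv G (b s) (basis_el w))"
  using assms
  by (simp add: right_op_def times_basis_el op_linear module_hom.zero[OF fun_hom_right_conv])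

lemma left_op_in_M: "s \<in> S \<Longrightarrow> x \<in> M \<Longrightarrow> left_op s x \<in> M"
  by (rule fun_hom_free_mod[OF fun_hom_left_op])
    (auto simp: left_op_basis_el intro!: free_mod_add free_mod_smult conv_free_mod)

text \<open>Right translation by a length-zero element changes neither \<open>len w\<close> nor
  \<open>len (n s \<otimes> w)\<close>, so it respects the case distinction in
  \<open>left_op\<close>. The rest is associativity of convolution.\<close>

lemma left_op_right_conv:
  assumes "s \<in> S" "f \<in> free_mod null"
  shows "left_op s (right_conv G f x) = right_conv G f (left_op s x)"
proof -
  have f: "f \<in> M" using assms(2) by (auto intro: free_mod_mono)
  have *: "len (n s \<otimes> (v \<otimes> inv y)) = len (n s \<otimes> v)" if "y \<in> null" "v \<in> carrier G" for y v
    using len_mult_null_inv[of y "n s \<otimes> v"] that assms by (simp add: m_assoc)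
  have "(\<lambda>w. if len w < len (n s \<otimes> w) then c else d) * right_conv G f x =
    right_conv G f ((\<lambda>w. if len w < len (n s \<otimes> w) then c else d) * x)" for c d x
    by (rule right_conv_times[OF assms(2), symmetric]) (use * len_mult_null_inv in auto)
  then show ?thesis
    unfolding left_op_def op_linear using assms f
    by (simp add: conv_right_conv)
qed

lemma right_op_conv:
  assumes "s \<in> S" "f \<in> free_mod null"
  shows "right_op s (conv G f x) = conv G f (right_op s x)"
proof -
  have f: "f \<in> M" using assms(2) by (auto intro: free_mod_mono)
  have *: "len (inv y \<otimes> v \<otimes> n s) = len (v \<otimes> n s)" if "y \<in> null" "v \<in> carrier G" for y v
    using len_null_inv_mult[of y "v \<otimes> n s"] that assms by (simp add: m_assoc)
  have "(\<lambda>w. if len w < len (w \<otimes> n s) then c else d) * conv G f x =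
    conv G f ((\<lambda>w. if len w < len (w \<otimes> n s) then c else d) * x)" for c d x
    by (rule conv_times[OF assms(2), symmetric]) (use * len_null_inv_mult in auto)
  then show ?thesis
    unfolding right_op_def op_linear using assms f
    by (simp add: conv_right_conv)
qed

lemma conv_eq_right_conv:
  assumes "s \<in> S" "t \<in> S" "w \<in> carrier G"
    and "len (n s \<otimes> w) = len (w \<otimes> n t)" "len (n s \<otimes> w \<otimes> n t) = len w"
  shows "a s = a t"
    and "conv G (b s) (basis_el (w \<otimes> n t)) = right_conv G (b t) (basis_el (n s \<otimes> w))"
proof -
  note fold = folding[OF assms]
  then show "a s = a t" by simp
  show "conv G (b s) (basis_el (w \<otimes> n t)) = right_conv G (b t) (basis_el (n s \<otimes> w))"
  proof
    fix v
    show "conv G (b s) (basis_el (w \<otimes> n t)) v = right_conv G (b t) (basis_el (n s \<otimes> w)) v"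
    proof (cases "v \<in> carrier G")
      case True
      with fold show ?thesis using assms
        by (simp add: conv_basis_el_apply right_conv_basis_el_apply)
    qed (simp add: conv_def right_conv_def)
  qed
qed

text \<open>Along each side of the square w, n_s w, w n_t, n_s w n_t the length changes by one,
  which leaves six patterns. In four of them associativity suffices; in the other two, collected in
  the first case, both pairs of opposite corners have equal length and folding applies.\<close>

lemma left_op_right_op_basis_el:
  assumes "s \<in> S" "t \<in> S" "w \<in> carrier G"
  shows "left_op s (right_op t (basis_el w)) = right_op t (left_op s (basis_el w))"
proof -
  have [simp]: "n s \<otimes> (w \<otimes> n t) = n s \<otimes> w \<otimes> n t" using assms by (simp add: m_assoc)
  note simps = left_op_basis_el right_op_basis_el op_linear left_op_right_conv right_op_conv
    b_null conv_right_conv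
  let ?sw = "len (n s \<otimes> w)" and ?wt = "len (w \<otimes> n t)" and ?swt = "len (n s \<otimes> w \<otimes> n t)"
  have "?sw = Suc (len w) \<or> len w = Suc ?sw" "?wt = Suc (len w) \<or> len w = Suc ?wt"
    "?swt = Suc ?wt \<or> ?wt = Suc ?swt" "?swt = Suc ?sw \<or> ?sw = Suc ?swt"
    using len_left[of s w] len_right[of t w] len_left[of s "w \<otimes> n t"] len_right[of t "n s \<otimes> w"] assms
    by simp_all
  then have "?sw = ?wt \<and> ?swt = len w
    \<or> ?sw = Suc (len w) \<and> ?wt = Suc (len w) \<and> ?swt = Suc (Suc (len w))
    \<or> len w = Suc ?sw \<and> len w = Suc ?wt \<and> len w = Suc (Suc ?swt)
    \<or> ?sw = Suc (len w) \<and> len w = Suc ?wt \<and> ?swt = len w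
    \<or> len w = Suc ?sw \<and> ?wt = Suc (len w) \<and> ?swt = len w"
    by (elim disjE) simp_all
  then consider "?sw = ?wt" "?swt = len w"
    | "?sw = Suc (len w)" "?wt = Suc (len w)" "?swt = Suc (Suc (len w))"
    | "len w = Suc ?sw" "len w = Suc ?wt" "len w = Suc (Suc ?swt)"
    | "?sw = Suc (len w)" "len w = Suc ?wt" "?swt = len w"
    | "len w = Suc ?sw" "?wt = Suc (len w)" "?swt = len w"
    by blast
  then show ?thesis
  proof cases
    case 1
    note eq = conv_eq_right_conv[OF assms 1]
    \<comment> \<open>If both neighbours of w are longer, b_s T_{w n_t} is compared with T_{n_s w}
      b_t. If both are shorter, these terms occur as the cross terms a_t b_s T_{w n_t} and a_s
      T_{n_s w} b_t.\<close>
    from len_left[OF assms(1,3)] show ?thesis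
    proof
      assume "len (n s \<otimes> w) = Suc (len w)"
      then show ?thesis using 1 assms by (simp add: simps eq)
    next
      assume "len w = Suc (len (n s \<otimes> w))"
      then show ?thesis using 1 assms by (simp add: simps eq)
    qed
  next
    case 2 then show ?thesis using assms by (simp add: simps)
  next
    case 3 then show ?thesis using assms
      by (simp add: simps fun_module.scale_right_distrib mult.commute add_ac)
  next
    case 4 then show ?thesis using assms by (simp add: simps)
  next
    case 5 then show ?thesis using assms by (simp add: simps)
  qed
qed

lemma left_op_right_op:
  assumes "s \<in> S" "t \<in> S" "x \<in> M"
  shows "left_op s (right_op t x) = right_op t (left_op s x)"
  using fun_hom_eq_on_free_mod[of "\<lambda>x. left_op s (right_op t x)" "\<lambda>x. right_op t (left_op s x)", OF _ _ _ assms(3)]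
    left_op_right_op_basis_el[OF assms(1,2)]
    module_hom_compose[OF fun_hom_left_op fun_hom_right_op, unfolded comp_def]
    module_hom_compose[OF fun_hom_right_op fun_hom_left_op, unfolded comp_def]
  by blast

section \<open>The commutant of the right operators\<close>

definition left_ops :: "(('g \<Rightarrow> 'r) \<Rightarrow> 'g \<Rightarrow> 'r) set" where
  "left_ops = {L. fun_hom L \<and> (\<forall>x\<in>M. L x \<in> M) \<and>
     (\<forall>t\<in>S. \<forall>x\<in>M. L (right_op t x) = right_op t (L x)) \<and>
     (\<forall>f\<in>free_mod null. \<forall>x\<in>M. L (right_conv G f x) = right_conv G f (L x))}"

lemma left_ops_hom: "L \<in> left_ops \<Longrightarrow> fun_hom L"
  and left_ops_in_M: "L \<in> left_ops \<Longrightarrow> x \<in> M \<Longrightarrow> L x \<in> M"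
  and left_ops_right_op: "L \<in> left_ops \<Longrightarrow> t \<in> S \<Longrightarrow> x \<in> M \<Longrightarrow> L (right_op t x) = right_op t (L x)"
  and left_ops_right_conv: "L \<in> left_ops \<Longrightarrow> f \<in> free_mod null \<Longrightarrow> x \<in> M \<Longrightarrow>
    L (right_conv G f x) = right_conv G f (L x)"
  by (auto simp: left_ops_def)

lemma left_ops_add: "L \<in> left_ops \<Longrightarrow> L' \<in> left_ops \<Longrightarrow> (\<lambda>x. L x + L' x) \<in> left_ops"
  by (auto simp: left_ops_def op_linear intro: fun_pair.module_hom_add free_mod_add)

lemma left_ops_smult: "L \<in> left_ops \<Longrightarrow> (\<lambda>x. smult_fun c (L x)) \<in> left_ops"
  by (auto simp: left_ops_def op_linear intro: fun_pair.module_hom_scale free_mod_smult)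

lemma left_ops_zero: "(\<lambda>x. 0) \<in> left_ops"
  by (auto simp: left_ops_def fun_pair.module_hom_zero module_hom.zero[OF fun_hom_right_op]
      module_hom.zero[OF fun_hom_right_conv] fun_module.subspace_0[OF subspace_free_mod])

lemma left_ops_compose: "L \<in> left_ops \<Longrightarrow> L' \<in> left_ops \<Longrightarrow> (\<lambda>x. L (L' x)) \<in> left_ops"
  using module_hom_compose[of smult_fun smult_fun L' smult_fun L, unfolded comp_def]
  by (auto simp: left_ops_def)

lemma left_op_left_ops: "s \<in> S \<Longrightarrow> left_op s \<in> left_ops"
  by (auto simp: left_ops_def fun_hom_left_op left_op_in_M left_op_right_op left_op_right_conv)

lemma conv_left_ops: "f \<in> free_mod null \<Longrightarrow> conv G f \<in> left_ops"
  by (simp add: left_ops_def fun_hom_conv conv_free_mod right_op_conv conv_right_conv null_in_M)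

text \<open>T_1 generates M under the right operations: T_u is T_1 multiplied by a length-zero u,
  and a right descent gives T_{v n_s} as \<open>right_op s\<close> of T_v. The first kind explains
  the convolution clause in \<open>left_ops\<close>. Agreement is limited to M, since commutation is
  required only there.\<close>

lemma left_ops_eqI:
  assumes "L \<in> left_ops" "L' \<in> left_ops" "L (basis_el \<one>) = L' (basis_el \<one>)" "x \<in> M"
  shows "L x = L' x"
proof (rule fun_hom_eq_on_free_mod[OF left_ops_hom left_ops_hom _ assms(4)])
  fix w assume "w \<in> carrier G"
  then show "L (basis_el w) = L' (basis_el w)"
  proof (induction "len w" arbitrary: w)
    case 0
    then have "(basis_el w :: 'g \<Rightarrow> 'r) \<in> free_mod null"
      "basis_el w = right_conv G (basis_el w) (basis_el \<one> :: 'g \<Rightarrow> 'r)" by auto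
    then show ?case
      using left_ops_right_conv[of L "basis_el w" "basis_el \<one>"]
        left_ops_right_conv[of L' "basis_el w" "basis_el \<one>"] assms(1-3) by simp
  next
    case (Suc k)
    then obtain s v where s: "s \<in> S" "v \<in> carrier G" "w = v \<otimes> n s" "len w = Suc (len v)"
      using right_descent[of w] by auto
    then have "basis_el w = right_op s (basis_el v)" by (simp add: right_op_basis_el)
    moreover have "L (basis_el v) = L' (basis_el v)" using s Suc by simp
    ultimately show ?case using left_ops_right_op assms s by simp
  qed
qed (use assms in auto)

text \<open>Compose the \<open>left_op\<close>s along a reduced factorisation of \<open>w\<close>,
  ending with convolution by a length-zero element. One operator serves all \<open>w'\<close>: w' =
  1 exhibits T_w as a value at T_1, and general \<open>w'\<close> yields relation (1).\<close>

lemma ex_left_op_basis_el: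
  assumes "w \<in> carrier G"
  shows "\<exists>L\<in>left_ops. \<forall>w'\<in>carrier G. len (w \<otimes> w') = len w + len w' \<longrightarrow>
    L (basis_el w') = basis_el (w \<otimes> w')"
  using assms
proof (induction "len w" arbitrary: w)
  case 0
  then show ?case
    by (intro bexI[of _ "conv G (basis_el w)"]) (simp_all add: conv_left_ops)
next
  case (Suc k)
  then obtain s v where s: "s \<in> S" "v \<in> carrier G" "w = n s \<otimes> v" "len w = Suc (len v)"
    using left_descent[of w] by auto
  then have "k = len v" using Suc.hyps(2) by simp
  from Suc.hyps(1)[OF this s(2)] obtain L where L: "L \<in> left_ops"
    "\<And>w'. w' \<in> carrier G \<Longrightarrow> len (v \<otimes> w') = len v + len w' \<Longrightarrow> L (basis_el w') = basis_el (v \<otimes> w')"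
    by blast
  have "left_op s (L (basis_el w')) = basis_el (w \<otimes> w')"
    if "w' \<in> carrier G" "len (w \<otimes> w') = len w + len w'" for w'
  proof -
    \<comment> \<open>Subadditivity gives one inequality. The other holds because n_s adds at most
      one to the length of v w', while w w' is longer than len v + len w' by exactly one.\<close>
    have "len (v \<otimes> w') = len v + len w'"
      using that s len_subadd[of v w'] len_left[of s "v \<otimes> w'"] by (simp add: m_assoc)
    then show ?thesis using that L s by (simp add: left_op_basis_el m_assoc)
  qed
  then show ?case
    by (intro bexI[OF _ left_ops_compose[OF left_op_left_ops[OF s(1)] L(1)]]) simp
qed

lemma ex_left_op:
  assumes "x \<in> M"
  shows "\<exists>L\<in>left_ops. L (basis_el \<one>) = x"
  using assms
proof (induction rule: free_mod_induct)
  case (basis w)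
  then obtain L where "L \<in> left_ops" "L (basis_el \<one>) = basis_el w"
    using ex_left_op_basis_el[of w] by (auto simp: len_one)
  then show ?case by auto
next
  case zero
  show ?case by (rule bexI[OF _ left_ops_zero]) simp
next
  case (add x y)
  then obtain L L' where L: "L \<in> left_ops" "L (basis_el \<one>) = x"
    and L': "L' \<in> left_ops" "L' (basis_el \<one>) = y"
    by auto
  show ?case by (rule bexI[OF _ left_ops_add[OF L(1) L'(1)]]) (simp add: L L')
next
  case (smult c x)
  then obtain L where "L \<in> left_ops" "L (basis_el \<one>) = x" by auto
  then show ?case by (intro bexI[OF _ left_ops_smult]) auto
qed

section \<open>The product and its relations\<close>

definition lmult :: "('g \<Rightarrow> 'r) \<Rightarrow> ('g \<Rightarrow> 'r) \<Rightarrow> 'g \<Rightarrow> 'r" where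
  "lmult x = (SOME L. L \<in> left_ops \<and> L (basis_el \<one>) = x)"

lemma lmult_left_ops: "x \<in> M \<Longrightarrow> lmult x \<in> left_ops"
  and lmult_one: "x \<in> M \<Longrightarrow> lmult x (basis_el \<one>) = x"
  using someI_ex[of "\<lambda>L. L \<in> left_ops \<and> L (basis_el \<one>) = x"] ex_left_op[of x]
  by (auto simp: lmult_def)

text \<open>On M the choice in \<open>lmult\<close> is immaterial. The laws below that change the
  left factor are checked by finding an operator in the commutant with the right value at
  T_1.\<close>

lemma lmult_eqI:
  "L \<in> left_ops \<Longrightarrow> L (basis_el \<one>) = x \<Longrightarrow> y \<in> M \<Longrightarrow> lmult x y = L y"
  using left_ops_eqI[OF lmult_left_ops, of x L y] left_ops_in_M[of L "basis_el \<one>"]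
  by (auto simp: lmult_one)

lemma lmult_algebra: "is_R_algebra_mult M lmult"
  unfolding is_R_algebra_mult_def
proof (intro conjI ballI allI)
  fix x y z c assume x: "x \<in> M" and y: "y \<in> M"
  show "lmult x y \<in> M" using lmult_left_ops x y left_ops_in_M by blast
  show "lmult (smult_fun c x) y = smult_fun c (lmult x y)"
    by (rule lmult_eqI) (use x y left_ops_smult lmult_left_ops lmult_one in auto)
  show "lmult x (smult_fun c y) = smult_fun c (lmult x y)"
    using fun_hom_smult[OF left_ops_hom[OF lmult_left_ops[OF x]]] .
  assume z: "z \<in> M"
  show "lmult (x + y) z = lmult x z + lmult y z"
    by (rule lmult_eqI) (use x y z left_ops_add lmult_left_ops lmult_one in auto)
  show "lmult x (y + z) = lmult x y + lmult x z"
    using fun_hom_add[OF left_ops_hom[OF lmult_left_ops[OF x]]] .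
  \<comment> \<open>The composite of the operators of x and y takes T_1 to their product, so
    associativity is composition of operators.\<close>
  show "lmult (lmult x y) z = lmult x (lmult y z)"
    by (rule lmult_eqI) (use x y z left_ops_compose lmult_left_ops lmult_one in auto)
next
  have "(\<lambda>x. x) \<in> left_ops" by (auto simp: left_ops_def fun_module.module_hom_ident)
  then have "lmult (basis_el \<one>) x = x" if "x \<in> M" for x
    using that by (intro lmult_eqI) auto
  then show "\<exists>e\<in>M. \<forall>x\<in>M. lmult e x = x \<and> lmult x e = x"
    by (intro bexI[of _ "basis_el \<one>"]) (auto simp: lmult_one)
qed

lemma lmult_basis_el:
  assumes "w \<in> carrier G" "w' \<in> carrier G" "len (w \<otimes> w') = len w + len w'"
  shows "lmult (basis_el w) (basis_el w') = basis_el (w \<otimes> w')"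
proof -
  obtain L where L: "L \<in> left_ops" "\<And>w'. w' \<in> carrier G \<Longrightarrow> len (w \<otimes> w') = len w + len w' \<Longrightarrow>
    L (basis_el w') = basis_el (w \<otimes> w')" using ex_left_op_basis_el[OF assms(1)] by auto
  then have "lmult (basis_el w) (basis_el w') = L (basis_el w')"
    using assms L(2)[of \<one>] by (intro lmult_eqI) (auto simp: len_one)
  then show ?thesis using L assms by simp
qed

text \<open>The case s = t, w = 1 of folding. It reconciles relation (2), with b_s on the right, and
  \<open>left_op\<close>, with b_s on the left.\<close>

lemma conv_n_eq_right_conv:
  "s \<in> S \<Longrightarrow> conv G (b s) (basis_el (n s)) = right_conv G (b s) (basis_el (n s))"
  using conv_eq_right_conv(2)[of s s \<one>] by (simp add: len_one len_square)

lemma lmult_quadratic: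
  assumes "s \<in> S"
  shows "lmult (basis_el (n s)) (basis_el (n s)) =
    smult_fun (a s) (basis_el (n s \<otimes> n s)) + lmult (basis_el (n s)) (b s)"
proof -
  have one: "left_op s (basis_el \<one>) = basis_el (n s)"
    using assms by (simp add: left_op_basis_el len_n len_one)
  have eq: "lmult (basis_el (n s)) x = left_op s x" if "x \<in> M" for x
    using that one assms left_op_left_ops by (intro lmult_eqI) auto
  \<comment> \<open>Write \<open>b s\<close> as T_1 times \<open>b s\<close>: since
    \<open>left_op s\<close> commutes with right convolution, it acts on T_1 only.\<close>
  have "left_op s (b s) = right_conv G (b s) (basis_el (n s))"
    using left_op_right_conv[OF assms b_null, OF assms, of "basis_el \<one>"] assms
    by (simp add: one right_conv_one)
  moreover have "left_op s (basis_el (n s)) =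
      smult_fun (a s) (basis_el (n s \<otimes> n s)) + conv G (b s) (basis_el (n s))"
    using assms by (simp add: left_op_basis_el len_n len_square)
  ultimately show ?thesis using assms by (simp add: eq conv_n_eq_right_conv)
qed

section \<open>Uniqueness of the product\<close>

definition hecke_mult :: "(('g \<Rightarrow> 'r) \<Rightarrow> ('g \<Rightarrow> 'r) \<Rightarrow> 'g \<Rightarrow> 'r) \<Rightarrow> bool" where
  "hecke_mult mul \<longleftrightarrow> is_R_algebra_mult M mul \<and>
     (\<forall>w\<in>carrier G. \<forall>w'\<in>carrier G. len (w \<otimes> w') = len w + len w' \<longrightarrow>
        mul (basis_el w) (basis_el w') = basis_el (w \<otimes> w')) \<and>
     (\<forall>s\<in>S. mul (basis_el (n s)) (basis_el (n s)) =
        smult_fun (a s) (basis_el (n s \<otimes> n s)) + mul (basis_el (n s)) (b s))"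

lemma hecke_mult_lmult: "hecke_mult lmult"
  using lmult_algebra lmult_basis_el lmult_quadratic by (simp add: hecke_mult_def)

lemma
  assumes "is_R_algebra_mult M mul" "x \<in> M" "y \<in> M"
  shows mult_closed: "mul x y \<in> M"
    and mult_smult_left: "mul (smult_fun c x) y = smult_fun c (mul x y)"
    and mult_smult_right: "mul x (smult_fun c y) = smult_fun c (mul x y)"
    and mult_add_left: "z \<in> M \<Longrightarrow> mul (x + y) z = mul x z + mul y z"
    and mult_add_right: "z \<in> M \<Longrightarrow> mul z (x + y) = mul z x + mul z y"
    and mult_assoc: "z \<in> M \<Longrightarrow> mul (mul x y) z = mul x (mul y z)"
  using assms by (auto simp: is_R_algebra_mult_def)

lemma
  assumes "is_R_algebra_mult M mul" "x \<in> M"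
  shows mult_zero_left: "mul 0 x = 0" and mult_zero_right: "mul x 0 = 0"
  using mult_smult_left[OF assms(1) assms(2,2), of 0] mult_smult_right[OF assms(1) assms(2,2), of 0]
  by auto

lemma hecke_mult_algebra: "hecke_mult mul \<Longrightarrow> is_R_algebra_mult M mul"
  by (simp add: hecke_mult_def)

text \<open>Lengths always add when one factor has length zero, so relation (1) fixes these products
  on basis elements and linearity in \<open>f\<close> does the rest.\<close>

lemma hecke_mult_null:
  assumes mul: "hecke_mult mul" and f: "f \<in> free_mod null" and w: "w \<in> carrier G"
  shows "mul f (basis_el w) = conv G f (basis_el w)"
    and "mul (basis_el w) f = right_conv G f (basis_el w)"
proof -
  note alg = hecke_mult_algebra[OF mul]
  have basis_null: "mul (basis_el u) (basis_el w) = basis_el (u \<otimes> w)"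
     "mul (basis_el w) (basis_el u) = basis_el (w \<otimes> u)" if "u \<in> null" for u
    using mul w that by (auto simp: hecke_mult_def len_null_mult len_mult_null)
  have w_in_M: "basis_el w \<in> M" using w by simp
  have "mul f (basis_el w) = conv G f (basis_el w) \<and>
    mul (basis_el w) f = right_conv G f (basis_el w)" using f
  proof (induction rule: free_mod_induct)
    case (basis u)
    then show ?case using w basis_null by simp
  next
    case zero
    then show ?case using mult_zero_left[OF alg w_in_M] mult_zero_right[OF alg w_in_M] w
      by (simp add: conv_def right_conv_def fsupp_def zero_fun_def cong: if_cong)
  next
    case (add x y)
    note M = null_in_M[OF add(1)] null_in_M[OF add(2)]
    \<comment> \<open>The support over which \<open>conv\<close> sums is not additive in the first
      argument; the closed formula for a basis element avoids it.\<close>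
    then have "conv G (x + y) (basis_el w) = conv G x (basis_el w) + conv G y (basis_el w)"
      "right_conv G (x + y) (basis_el w) = right_conv G x (basis_el w) + right_conv G y (basis_el w)"
      using w free_mod_add[OF M] by (auto simp: conv_basis_el_eq right_conv_basis_el_eq plus_fun_def)
    then show ?case
      using add mult_add_left[OF alg M w_in_M] mult_add_right[OF alg M w_in_M] by simp
  next
    case (smult c x)
    note M = null_in_M[OF smult(1)]
    then have "conv G (smult_fun c x) (basis_el w) = smult_fun c (conv G x (basis_el w))"
      "right_conv G (smult_fun c x) (basis_el w) = smult_fun c (right_conv G x (basis_el w))"
      using w free_mod_smult[OF M]
      by (auto simp: conv_basis_el_eq right_conv_basis_el_eq smult_fun_def)
    then show ?case
      using smult mult_smult_left[OF alg M w_in_M] mult_smult_right[OF alg w_in_M M] by simp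
  qed
  then show "mul f (basis_el w) = conv G f (basis_el w)"
    and "mul (basis_el w) f = right_conv G f (basis_el w)" by auto
qed

text \<open>In the lengthening case this is relation (1). Otherwise T_w = T_{n_s} T_v with v
  shorter, and relation (2) applies to the two equal factors in T_{n_s} T_{n_s} T_v.\<close>

lemma hecke_mult_n:
  assumes mul: "hecke_mult mul" and s: "s \<in> S" and w: "w \<in> carrier G"
  shows "mul (basis_el (n s)) (basis_el w) = left_op s (basis_el w)"
proof (cases "len w < len (n s \<otimes> w)")
  case True
  then have "len (n s \<otimes> w) = len (n s) + len w" using len_left[OF s w] s by (auto simp: len_n)
  then show ?thesis using mul s w True by (auto simp: hecke_mult_def left_op_basis_el)
next
  case False
  note alg = hecke_mult_algebra[OF mul]
  define v where "v = inv (n s) \<otimes> w"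
  have v: "v \<in> carrier G" "w = n s \<otimes> v" using s w by (auto simp: v_def simp flip: m_assoc)
  \<comment> \<open>n_s w is n_s^2 v, and n_s^2 has length zero.\<close>
  have len_v: "len (n s \<otimes> w) = len v"
    using v s len_null_mult[of "n s \<otimes> n s" v] by (simp add: len_square m_assoc)
  then have len_w: "len (n s \<otimes> v) = len (n s) + len v"
    using False len_left[OF s w] s by (auto simp: len_n simp flip: v(2))
  let ?s = "basis_el (n s) :: 'g \<Rightarrow> 'r" and ?v = "basis_el v :: 'g \<Rightarrow> 'r"
  have M: "?s \<in> M" "?v \<in> M" "b s \<in> M" "basis_el (n s \<otimes> n s) \<in> M" using s v by auto
  have sv: "mul ?s ?v = basis_el w" using mul s v(1) len_w by (simp add: hecke_mult_def v(2))
  have "mul ?s (basis_el w) = mul (mul ?s ?s) ?v"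
    using mult_assoc[OF alg M(1,1,2)] sv by simp
  \<comment> \<open>\<open>b s\<close> is moved to the left of T_{n_s} so that T_{n_s} T_v can be
    recombined to T_w.\<close>
  also have "mul ?s ?s = smult_fun (a s) (basis_el (n s \<otimes> n s)) + mul (b s) ?s"
    using mul s hecke_mult_null[OF mul b_null[OF s], of "n s"] conv_n_eq_right_conv[OF s]
    by (simp add: hecke_mult_def)
  also have "mul \<dots> ?v = smult_fun (a s) (mul (basis_el (n s \<otimes> n s)) ?v) + mul (mul (b s) ?s) ?v"
    using mult_add_left[OF alg free_mod_smult[OF M(4)] mult_closed[OF alg M(3,1)] M(2)]
      mult_smult_left[OF alg M(4,2)] by simp
  also have "mul (mul (b s) ?s) ?v = conv G (b s) (basis_el w)"
    using mult_assoc[OF alg M(3,1,2)] sv hecke_mult_null[OF mul b_null[OF s] w] by simp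
  also have "mul (basis_el (n s \<otimes> n s)) ?v = basis_el (n s \<otimes> w)"
    using mul s v len_v by (simp add: hecke_mult_def len_square m_assoc)
  finally show ?thesis using False s w by (simp add: left_op_basis_el)
qed

text \<open>The T_{n_s} and the T_u with u of length zero generate M, and left multiplication by
  them is already forced. For T_{n_s} agreement is needed against all of M, because peeling n_s off
  the left factor leaves a product that need not be a basis element.\<close>

lemma hecke_mult_unique:
  assumes mul: "hecke_mult mul" and mul': "hecke_mult mul'" and x: "x \<in> M" and y: "y \<in> M"
  shows "mul x y = mul' x y"
proof -
  note alg = hecke_mult_algebra[OF mul] and alg' = hecke_mult_algebra[OF mul']
  have n: "mul (basis_el (n s)) y = mul' (basis_el (n s)) y" if s: "s \<in> S" and y: "y \<in> M" for s y
    using y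
  proof (induction rule: free_mod_induct)
    case (basis w)
    then show ?case using hecke_mult_n[OF mul s] hecke_mult_n[OF mul' s] by simp
  next
    case zero
    show ?case using s by (simp add: mult_zero_right[OF alg] mult_zero_right[OF alg'])
  next
    case (add x y)
    then show ?case using s by (simp add: mult_add_right[OF alg] mult_add_right[OF alg'])
  next
    case (smult c x)
    then show ?case using s by (simp add: mult_smult_right[OF alg] mult_smult_right[OF alg'])
  qed
  have basis_mult: "mul (basis_el w) (basis_el v) = mul' (basis_el w) (basis_el v)"
    if "w \<in> carrier G" and v: "v \<in> carrier G" for w v
    using that(1)
  proof (induction "len w" arbitrary: w)
    case 0
    then show ?case using hecke_mult_null(1)[OF mul _ v, of "basis_el w"]
      hecke_mult_null(1)[OF mul' _ v, of "basis_el w"] by simp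
  next
    case (Suc k)
    then obtain s u where s: "s \<in> S" "u \<in> carrier G" "w = n s \<otimes> u" "len w = Suc (len u)"
      using left_descent[of w] by auto
    then have w: "mul (basis_el (n s)) (basis_el u) = basis_el w"
      "mul' (basis_el (n s)) (basis_el u) = basis_el w"
      using mul mul' by (auto simp: hecke_mult_def len_n)
    have M: "basis_el (n s) \<in> M" "basis_el u \<in> M" "basis_el v \<in> M" using s v by auto
    have "mul (basis_el w) (basis_el v) = mul (basis_el (n s)) (mul (basis_el u) (basis_el v))"
      using mult_assoc[OF alg M] w by simp
    also have "\<dots> = mul' (basis_el (n s)) (mul (basis_el u) (basis_el v))"
      using s(1) mult_closed[OF alg M(2,3)] by (rule n)
    also have "mul (basis_el u) (basis_el v) = mul' (basis_el u) (basis_el v)"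
      using Suc.hyps(1)[of u] Suc.hyps(2) s by simp
    also have "mul' (basis_el (n s)) \<dots> = mul' (basis_el w) (basis_el v)"
      using mult_assoc[OF alg' M] w by simp
    finally show ?case .
  qed
  have "mul x (basis_el v) = mul' x (basis_el v)" if v: "v \<in> carrier G" for v
    using x
  proof (induction rule: free_mod_induct)
    case (basis w)
    then show ?case using basis_mult v by simp
  next
    case zero
    show ?case using v by (simp add: mult_zero_left[OF alg] mult_zero_left[OF alg'])
  next
    case (add x y)
    then show ?case using v by (simp add: mult_add_left[OF alg] mult_add_left[OF alg'])
  next
    case (smult c x)
    then show ?case using v by (simp add: mult_smult_left[OF alg] mult_smult_left[OF alg'])
  qed
  note left = this
  show ?thesis using y
  proof (induction rule: free_mod_induct)
    case (basis v)
    then show ?case by (rule left)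
  next
    case zero
    show ?case using x by (simp add: mult_zero_right[OF alg] mult_zero_right[OF alg'])
  next
    case (add y z)
    then show ?case using x by (simp add: mult_add_right[OF alg] mult_add_right[OF alg'])
  next
    case (smult c y)
    then show ?case using x by (simp add: mult_smult_right[OF alg] mult_smult_right[OF alg'])
  qed
qed

end

subsection \<open>Pro-$p$ Coxeter groups\<close>

theorem theorem2p3p1:
  fixes W1 :: "'g monoid" and T :: "'g set" and W :: "'w monoid"
    and Waff Omega S :: "'w set" and proj :: "'g \<Rightarrow> 'w" and n :: "'w \<Rightarrow> 'g"
    and a :: "'w \<Rightarrow> 'r::comm_ring_1" and b :: "'w \<Rightarrow> 'g \<Rightarrow> 'r"
  assumes proP: "pro_p_coxeter W1 T W Waff Omega S proj n"
    and b_in: "\<forall>s\<in>S. b s \<in> free_mod T"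
    and compat: "\<forall>s\<in>S. \<forall>t\<in>S. \<forall>w\<in>carrier W1.
        s \<otimes>\<^bsub>W\<^esub> proj w = proj w \<otimes>\<^bsub>W\<^esub> t \<longrightarrow>
          a s = a t \<and>
          conv W1 (basis_el (n s \<otimes>\<^bsub>W1\<^esub> w \<otimes>\<^bsub>W1\<^esub> inv\<^bsub>W1\<^esub> (n t) \<otimes>\<^bsub>W1\<^esub> inv\<^bsub>W1\<^esub> w))
                  (conj_act W1 w (b t)) = b s"
  shows "\<exists>mul. (is_R_algebra_mult (free_mod (carrier W1)) mul \<and>
            (\<forall>w\<in>carrier W1. \<forall>w'\<in>carrier W1.
               ext_length W Waff Omega S (proj (w \<otimes>\<^bsub>W1\<^esub> w')) =
                 ext_length W Waff Omega S (proj w) + ext_length W Waff Omega S (proj w') \<longrightarrow>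
               mul (basis_el w) (basis_el w') = basis_el (w \<otimes>\<^bsub>W1\<^esub> w')) \<and>
            (\<forall>s\<in>S. mul (basis_el (n s)) (basis_el (n s)) =
               smult_fun (a s) (basis_el (n s \<otimes>\<^bsub>W1\<^esub> n s)) + mul (basis_el (n s)) (b s)))
         \<and> (\<forall>mul'. (is_R_algebra_mult (free_mod (carrier W1)) mul' \<and>
            (\<forall>w\<in>carrier W1. \<forall>w'\<in>carrier W1.
               ext_length W Waff Omega S (proj (w \<otimes>\<^bsub>W1\<^esub> w')) =
                 ext_length W Waff Omega S (proj w) + ext_length W Waff Omega S (proj w') \<longrightarrow>
               mul' (basis_el w) (basis_el w') = basis_el (w \<otimes>\<^bsub>W1\<^esub> w')) \<and>
            (\<forall>s\<in>S. mul' (basis_el (n s)) (basis_el (n s)) =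
               smult_fun (a s) (basis_el (n s \<otimes>\<^bsub>W1\<^esub> n s)) + mul' (basis_el (n s)) (b s)))
            \<longrightarrow> (\<forall>x\<in>free_mod (carrier W1). \<forall>y\<in>free_mod (carrier W1). mul' x y = mul x y))"
proof -
  have W1: "group W1" and ext: "extended_coxeter W Waff Omega S" and T: "subgroup T W1"
    and hom: "proj \<in> hom W1 W" and ker: "kernel W1 W proj = T" and n: "\<And>s. s \<in> S \<Longrightarrow> n s \<in> carrier W1 \<and> proj (n s) = s"
    using proP by (auto simp: pro_p_coxeter_def)
  interpret G: group W1 by (rule W1)
  have W: "group W" using ext by (simp add: extended_coxeter_def)
  interpret E: extended_coxeter_group W Waff Omega S
    by (intro extended_coxeter_group.intro extended_coxeter_group_axioms.intro W ext)
  interpret P: group_hom W1 W proj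
    by (intro group_hom.intro group_hom_axioms.intro W1 W hom)
  note proj_simps = P.hom_mult P.hom_closed n
  \<comment> \<open>The length is pulled back along \<open>proj\<close>, so its length-zero elements
    are exactly the lifts of \<open>Omega\<close>.\<close>
  interpret hecke_datum W1 S n T "\<lambda>w. E.len (proj w)" a b
  proof (unfold_locales, goal_cases)
    case (1 s) then show ?case using n by simp
  next
    case 2 show ?case by (rule subgroup.subset[OF T])
  next
    case (3 s) then show ?case using b_in by simp
  next
    case (4 x) then show ?case using ker by (auto simp: kernel_def E.len_one)
  next
    case 5 show ?case by (simp add: E.len_one)
  next
    case (6 s) then show ?case by (simp add: proj_simps E.S_square E.len_one)
  next
    case (7 u w) then show ?case using E.len_eq_0[of "proj u"] by (simp add: proj_simps E.len_Omega_mult)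
  next
    case (8 u w) then show ?case using E.len_eq_0[of "proj u"] by (simp add: proj_simps E.len_mult_Omega)
  next
    case (9 s w) then show ?case using E.len_gen_mult[of s "proj w"] by (simp add: proj_simps)
  next
    case (10 s w) then show ?case using E.len_mult_gen[of s "proj w"] by (simp add: proj_simps)
  next
    case (11 w)
    then obtain s where s: "s \<in> S" "E.len (proj w) = Suc (E.len (s \<otimes>\<^bsub>W\<^esub> proj w))"
      using E.len_left_descent[of "proj w"] by auto
    let ?v = "inv\<^bsub>W1\<^esub> (n s) \<otimes>\<^bsub>W1\<^esub> w"
    have "w = n s \<otimes>\<^bsub>W1\<^esub> ?v" using 11 s n by (simp flip: G.m_assoc)
    moreover have "proj ?v = s \<otimes>\<^bsub>W\<^esub> proj w" using 11 s n by (simp add: E.S_inv)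
    ultimately show ?case using 11 s n by (intro bexI[of _ s] bexI[of _ ?v]) auto
  next
    case (12 w)
    then obtain s where s: "s \<in> S" "E.len (proj w) = Suc (E.len (proj w \<otimes>\<^bsub>W\<^esub> s))"
      using E.len_right_descent[of "proj w"] by auto
    let ?v = "w \<otimes>\<^bsub>W1\<^esub> inv\<^bsub>W1\<^esub> (n s)"
    have "w = ?v \<otimes>\<^bsub>W1\<^esub> n s" using 12 s n by (simp add: G.m_assoc)
    moreover have "proj ?v = proj w \<otimes>\<^bsub>W\<^esub> s" using 12 s n by (simp add: E.S_inv)
    ultimately show ?case using 12 s n by (intro bexI[of _ s] bexI[of _ ?v]) auto
  next
    case (13 s t w)
    have comm: "s \<otimes>\<^bsub>W\<^esub> proj w = proj w \<otimes>\<^bsub>W\<^esub> t"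
      using 13 E.len_folding[of s t "proj w"] by (simp add: proj_simps)
    have conv: "conv W1 (basis_el z) f x = f (inv\<^bsub>W1\<^esub> z \<otimes>\<^bsub>W1\<^esub> x)" if "x \<in> carrier W1"
      for z x and f :: "'g \<Rightarrow> 'r"
      using that unfolding conv_def by simp (simp add: basis_el_def)
    \<comment> \<open>The coefficientwise form of compatibility is kept general in s', t', w': it is
      used for the given triple and again for t, t, n_t.\<close>
    have b: "b s' x = b t' (n t' \<otimes>\<^bsub>W1\<^esub> inv\<^bsub>W1\<^esub> w' \<otimes>\<^bsub>W1\<^esub> inv\<^bsub>W1\<^esub> (n s') \<otimes>\<^bsub>W1\<^esub> x \<otimes>\<^bsub>W1\<^esub> w')"
      if "s' \<in> S" "t' \<in> S" "w' \<in> carrier W1" "s' \<otimes>\<^bsub>W\<^esub> proj w' = proj w' \<otimes>\<^bsub>W\<^esub> t'"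
        "x \<in> carrier W1" for s' t' w' x
    proof -
      let ?z = "n s' \<otimes>\<^bsub>W1\<^esub> w' \<otimes>\<^bsub>W1\<^esub> inv\<^bsub>W1\<^esub> (n t') \<otimes>\<^bsub>W1\<^esub> inv\<^bsub>W1\<^esub> w'"
      have nn: "n s' \<in> carrier W1" "n t' \<in> carrier W1" using n that by auto
      have "b s' x = conv W1 (basis_el ?z) (conj_act W1 w' (b t')) x"
        using compat that by auto
      also have "\<dots> = b t' (inv\<^bsub>W1\<^esub> w' \<otimes>\<^bsub>W1\<^esub> (inv\<^bsub>W1\<^esub> ?z \<otimes>\<^bsub>W1\<^esub> x) \<otimes>\<^bsub>W1\<^esub> w')"
        using that nn by (simp add: conv conj_act_def)
      also have "inv\<^bsub>W1\<^esub> ?z = w' \<otimes>\<^bsub>W1\<^esub> (n t' \<otimes>\<^bsub>W1\<^esub> inv\<^bsub>W1\<^esub> w' \<otimes>\<^bsub>W1\<^esub> inv\<^bsub>W1\<^esub> (n s'))"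
        using that nn by (simp add: G.inv_mult_group G.m_assoc)
      also have "inv\<^bsub>W1\<^esub> w' \<otimes>\<^bsub>W1\<^esub> (w' \<otimes>\<^bsub>W1\<^esub> (n t' \<otimes>\<^bsub>W1\<^esub> inv\<^bsub>W1\<^esub> w' \<otimes>\<^bsub>W1\<^esub> inv\<^bsub>W1\<^esub> (n s')) \<otimes>\<^bsub>W1\<^esub> x) =
        n t' \<otimes>\<^bsub>W1\<^esub> inv\<^bsub>W1\<^esub> w' \<otimes>\<^bsub>W1\<^esub> inv\<^bsub>W1\<^esub> (n s') \<otimes>\<^bsub>W1\<^esub> x"
        using that nn by (simp add: G.m_assoc[symmetric])
      finally show ?thesis .
    qed
    show ?case
    proof (intro conjI ballI)
      show "a s = a t" using compat 13 comm by blast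
      fix v assume v: "v \<in> carrier W1"
      have nn: "n s \<in> carrier W1" "n t \<in> carrier W1" using n 13 by auto
      let ?y = "inv\<^bsub>W1\<^esub> w \<otimes>\<^bsub>W1\<^esub> inv\<^bsub>W1\<^esub> (n s) \<otimes>\<^bsub>W1\<^esub> v"
      \<comment> \<open>This instance still leaves the argument conjugated by n_t.\<close>
      have "b s (v \<otimes>\<^bsub>W1\<^esub> inv\<^bsub>W1\<^esub> (w \<otimes>\<^bsub>W1\<^esub> n t)) = b t (n t \<otimes>\<^bsub>W1\<^esub> ?y \<otimes>\<^bsub>W1\<^esub> inv\<^bsub>W1\<^esub> (n t))"
        using b[OF 13(1-3) comm, of "v \<otimes>\<^bsub>W1\<^esub> inv\<^bsub>W1\<^esub> (w \<otimes>\<^bsub>W1\<^esub> n t)"]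
          v nn 13(3)
        by (simp add: G.inv_mult_group G.m_assoc)
      \<comment> \<open>The instance t, t, n_t states that \<open>b t\<close> is invariant under
        conjugation by n_t, which removes the conjugation.\<close>
      also have "\<dots> = b t ?y"
        using b[OF 13(2,2), of "n t" "n t \<otimes>\<^bsub>W1\<^esub> ?y \<otimes>\<^bsub>W1\<^esub> inv\<^bsub>W1\<^esub> (n t)"]
          v nn 13 n
        by (simp add: G.m_assoc) (simp add: G.m_assoc[symmetric])
      finally show "b s (v \<otimes>\<^bsub>W1\<^esub> inv\<^bsub>W1\<^esub> (w \<otimes>\<^bsub>W1\<^esub> n t)) =
          b t (inv\<^bsub>W1\<^esub> (n s \<otimes>\<^bsub>W1\<^esub> w) \<otimes>\<^bsub>W1\<^esub> v)"
        using nn v 13(3) by (simp add: G.inv_mult_group G.m_assoc)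
    qed
  qed
  show ?thesis
    by (rule exI[of _ lmult], unfold hecke_mult_def[symmetric])
      (use hecke_mult_lmult hecke_mult_unique in blast)
qed


end
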